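(* Let $n\geq 1$ and let $\mathbb{T}^n$ be the $n$-dimensional torus. For any $\varkappa>0$, there exists a non-elliptic pseudo-differential operator $A$ such that $A\in\Psi^{-\varkappa}_{0,0}(\mathbb{T}^n)\setminus\Psi^{-\varkappa-\varepsilon}_{0,0}(\mathbb{T}^n)$ for all $\varepsilon>0$, and such that $A$ belongs to all the Schatten ideals $\mathscr{S}_r(L^2(\mathbb{T}^n))$, $r>0$.
   Context: For $0<r<\infty$, a compact operator $T$ on $L^2(\mathbb{T}^n)$ belongs to $\mathscr{S}_r(L^2(\mathbb{T}^n))$ if its singular values (the eigenvalues of $\sqrt{T^*T}$) form a sequence in $\ell^r(\mathbb{N})$. For $m\in\mathbb{R}$, $\Psi^m_{0,0}(\mathbb{T}^n)$ is the global Hörmander class of the compact Lie group $G=\mathbb{T}^n$, with $\widehat{\mathbb{T}^n}\cong\mathbb{Z}^n$: the operators $Af(x)=\sum_{\xi\in\mathbb{Z}^n}e^{2\pi i x\cdot\xi}a(x,\xi)\widehat f(\xi)$, $f\in C^\infty(\mathbb{T}^n)$, whose symbols $a:\mathbb{T}^n\times\mathbb{Z}^n\to\mathbb{C}$ satisfy $|\partial_x^\beta\Delta_\xi^\alpha a(x,\xi)|\le C_{\alpha,\beta}\langle\xi\rangle^{m}$ for all multi-indices $\alpha,\beta$. Here $\Delta_\xi^\alpha$ are iterated difference operators generated by $\Delta^{e_j}a(\xi)=a(\xi+e_j)-a(\xi)$, and $\langle\xi\rangle=(1+\lambda_\xi)^{1/2}$, where $\lambda_\xi$ is the eigenvalue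 of the positive Laplacian on $e^{2\pi i x\cdot\xi}$ (so $\langle\xi\rangle\asymp1+|\xi|$). An operator of order $m$ is elliptic if $|a(x,\xi)|\ge c\langle\xi\rangle^m$ for some $c>0$ and all $x\in\mathbb{T}^n$ and all but finitely many $\xi\in\mathbb{Z}^n$; here $m=-\varkappa$. *)

theory Defs
  imports "HOL-Analysis.Analysis"
begin

section \<open>The torus and its characters\<close>

text \<open>
  The torus is \<open>\<real>\<^sup>n / \<int>\<^sup>n\<close> with \<open>n = CARD('n)\<close>. Functions on it are the \<open>\<int>\<^sup>n\<close>-periodic functions on
  \<open>real ^ 'n\<close>, and its unitary dual is \<open>int ^ 'n\<close>. Integration over the torus is integration
  over the unit cube; the boundary of the cube is a null set.
\<close>

definition lattice_vec :: "int ^ 'n \<Rightarrow> real ^ 'n" where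
  "lattice_vec \<xi> = (\<chi> j. real_of_int (\<xi> $ j))"

definition torus_fun :: "(real ^ 'n \<Rightarrow> 'a) \<Rightarrow> bool" where
  "torus_fun f \<longleftrightarrow> (\<forall>x k. f (x + lattice_vec k) = f x)"

definition torus_measure :: "(real ^ 'n) measure" where
  "torus_measure = restrict_space lborel (cbox 0 1)"

definition torus_char :: "int ^ 'n \<Rightarrow> real ^ 'n \<Rightarrow> complex" where
  "torus_char \<xi> x = exp (2 * of_real pi * \<i> * of_real (x \<bullet> lattice_vec \<xi>))"

definition fourier_coeff :: "(real ^ 'n \<Rightarrow> complex) \<Rightarrow> int ^ 'n \<Rightarrow> complex" where
  "fourier_coeff f \<xi> = (LINT x|torus_measure. f x * cnj (torus_char \<xi> x))"

text \<open>\<open>4 \<pi>\<^sup>2 |\<xi>|\<^sup>2\<close> is the eigenvalue of the positive Laplacian on \<open>torus_char \<xi>\<close>.\<close>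

definition japanese_bracket :: "int ^ 'n \<Rightarrow> real" where
  "japanese_bracket \<xi> = sqrt (1 + 4 * pi\<^sup>2 * (norm (lattice_vec \<xi>))\<^sup>2)"


section \<open>Pseudo-differential operators\<close>

definition partial_deriv :: "'n \<Rightarrow> (real ^ 'n \<Rightarrow> complex) \<Rightarrow> real ^ 'n \<Rightarrow> complex" where
  "partial_deriv j f x = vector_derivative (\<lambda>t. f (x + t *\<^sub>R axis j 1)) (at 0)"

definition partial_diff :: "'n \<Rightarrow> (int ^ 'n \<Rightarrow> complex) \<Rightarrow> int ^ 'n \<Rightarrow> complex" where
  "partial_diff j a \<xi> = a (\<xi> + axis j 1) - a \<xi>"

text \<open>
  A multi-index is given as a list of coordinate directions; the list \<open>js\<close> stands for the
  multi-index whose \<open>j\<close>-th entry is the number of occurrences of \<open>j\<close> in \<open>js\<close>. Differences commute, and so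
  do partial derivatives of smooth functions, so the order in the list is immaterial.
\<close>

abbreviation partial_derivs :: "'n list \<Rightarrow> (real ^ 'n \<Rightarrow> complex) \<Rightarrow> real ^ 'n \<Rightarrow> complex" where
  "partial_derivs \<equiv> foldr partial_deriv"

abbreviation partial_diffs :: "'n list \<Rightarrow> (int ^ 'n \<Rightarrow> complex) \<Rightarrow> int ^ 'n \<Rightarrow> complex" where
  "partial_diffs \<equiv> foldr partial_diff"

definition torus_smooth :: "(real ^ 'n \<Rightarrow> complex) \<Rightarrow> bool" where
  "torus_smooth f \<longleftrightarrow> torus_fun f \<and>
     (\<forall>js. continuous_on UNIV (partial_derivs js f) \<and>
           (\<forall>j x. (\<lambda>t. partial_derivs js f (x + t *\<^sub>R axis j 1)) differentiable (at 0)))"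

definition symbol_class_00 :: "real \<Rightarrow> (real ^ 'n \<Rightarrow> int ^ 'n \<Rightarrow> complex) set" where
  "symbol_class_00 m = {a. (\<forall>\<xi>. torus_smooth (\<lambda>x. a x \<xi>)) \<and>
     (\<forall>\<alpha> \<beta>. \<exists>C. \<forall>x \<xi>. cmod (partial_derivs \<beta> (\<lambda>y. partial_diffs \<alpha> (a y) \<xi>) x)
                          \<le> C * japanese_bracket \<xi> powr m)}"

definition quantization ::
  "(real ^ 'n \<Rightarrow> int ^ 'n \<Rightarrow> complex) \<Rightarrow> (real ^ 'n \<Rightarrow> complex) \<Rightarrow> real ^ 'n \<Rightarrow> complex" where
  "quantization a f x = (\<Sum>\<^sub>\<infinity>\<xi>\<in>UNIV. torus_char \<xi> x * a x \<xi> * fourier_coeff f \<xi>)"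

text \<open>Operators act on smooth functions; their values elsewhere are irrelevant.\<close>

definition has_symbol ::
  "((real ^ 'n \<Rightarrow> complex) \<Rightarrow> (real ^ 'n \<Rightarrow> complex)) \<Rightarrow> (real ^ 'n \<Rightarrow> int ^ 'n \<Rightarrow> complex) \<Rightarrow> bool"
  where "has_symbol A a \<longleftrightarrow> (\<forall>f. torus_smooth f \<longrightarrow> A f = quantization a f)"

definition Psi_00 :: "real \<Rightarrow> ((real ^ 'n \<Rightarrow> complex) \<Rightarrow> (real ^ 'n \<Rightarrow> complex)) set" where
  "Psi_00 m = {A. \<exists>a\<in>symbol_class_00 m. has_symbol A a}"

definition elliptic :: "real \<Rightarrow> ((real ^ 'n \<Rightarrow> complex) \<Rightarrow> (real ^ 'n \<Rightarrow> complex)) \<Rightarrow> bool" where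
  "elliptic m A \<longleftrightarrow> (\<exists>a\<in>symbol_class_00 m. has_symbol A a \<and>
     (\<exists>c>0. \<exists>F. finite F \<and> (\<forall>x. \<forall>\<xi>\<in>-F. cmod (a x \<xi>) \<ge> c * japanese_bracket \<xi> powr m)))"


section \<open>The Hilbert space of square integrable functions on the torus\<close>

definition square_integrable :: "(real ^ 'n \<Rightarrow> complex) \<Rightarrow> bool" where
  "square_integrable f \<longleftrightarrow> torus_fun f \<and> f \<in> borel_measurable borel \<and>
     integrable torus_measure (\<lambda>x. (cmod (f x))\<^sup>2)"

definition L2_eq :: "(real ^ 'n \<Rightarrow> complex) \<Rightarrow> (real ^ 'n \<Rightarrow> complex) \<Rightarrow> bool" where
  "L2_eq f g \<longleftrightarrow> square_integrable f \<and> square_integrable g \<and> (AE x in torus_measure. f x = g x)"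

lemma square_integrable_zero: "square_integrable (\<lambda>_. 0)"
  by (simp add: square_integrable_def torus_fun_def)

lemma measurable_torus_measure:
  "f \<in> borel_measurable borel \<Longrightarrow> f \<in> borel_measurable torus_measure"
  unfolding torus_measure_def by (intro measurable_restrict_space1) simp

lemma square_integrable_add:
  assumes "square_integrable f" "square_integrable g"
  shows "square_integrable (\<lambda>x. f x + g x)"
proof -
  have f: "f \<in> borel_measurable borel" and g: "g \<in> borel_measurable borel"
    using assms by (auto simp: square_integrable_def)
  have le: "(cmod (u + v))\<^sup>2 \<le> 2 * (cmod u)\<^sup>2 + 2 * (cmod v)\<^sup>2" for u v :: complex
  proof -
    have "(cmod (u + v))\<^sup>2 \<le> (cmod u + cmod v)\<^sup>2"
      by (intro power_mono norm_triangle_ineq) auto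
    also have "\<dots> \<le> 2 * (cmod u)\<^sup>2 + 2 * (cmod v)\<^sup>2"
      using sum_squares_bound[of "cmod u" "cmod v"] by (simp add: power2_sum)
    finally show ?thesis .
  qed
  have "integrable torus_measure (\<lambda>x. (cmod (f x + g x))\<^sup>2)"
  proof (rule Bochner_Integration.integrable_bound)
    show "integrable torus_measure (\<lambda>x. 2 * (cmod (f x))\<^sup>2 + 2 * (cmod (g x))\<^sup>2)"
      using assms by (auto simp: square_integrable_def)
    show "(\<lambda>x. (cmod (f x + g x))\<^sup>2) \<in> borel_measurable torus_measure"
      using f g by (intro measurable_torus_measure) measurable
    show "AE x in torus_measure. norm ((cmod (f x + g x))\<^sup>2)
            \<le> norm (2 * (cmod (f x))\<^sup>2 + 2 * (cmod (g x))\<^sup>2)"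
      using le by (intro AE_I2) simp
  qed
  then show ?thesis
    using assms f g by (simp add: square_integrable_def torus_fun_def)
qed

lemma square_integrable_cmult:
  assumes "square_integrable f"
  shows "square_integrable (\<lambda>x. c * f x)"
  using assms by (auto simp: square_integrable_def torus_fun_def norm_mult power_mult_distrib)

lemma square_integrable_prod:
  assumes "square_integrable f" "square_integrable g"
  shows "integrable torus_measure (\<lambda>x. f x * cnj (g x))"
proof (rule Bochner_Integration.integrable_bound)
  have f: "f \<in> borel_measurable borel" and g: "g \<in> borel_measurable borel"
    using assms by (auto simp: square_integrable_def)
  show "integrable torus_measure (\<lambda>x. (cmod (f x))\<^sup>2 + (cmod (g x))\<^sup>2)"
    using assms by (auto simp: square_integrable_def)
  have "cnj \<in> borel_measurable borel"
    by (intro borel_measurable_continuous_onI continuous_intros)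
  then have "(\<lambda>x. cnj (g x)) \<in> borel_measurable borel"
    using g by measurable
  then show "(\<lambda>x. f x * cnj (g x)) \<in> borel_measurable torus_measure"
    using f by (intro measurable_torus_measure) measurable
  have "cmod u * cmod v \<le> (cmod u)\<^sup>2 + (cmod v)\<^sup>2" for u v
  proof -
    have "0 \<le> cmod u * cmod v" by simp
    then show ?thesis using sum_squares_bound[of "cmod u" "cmod v"] by linarith
  qed
  then show "AE x in torus_measure. norm (f x * cnj (g x)) \<le> norm ((cmod (f x))\<^sup>2 + (cmod (g x))\<^sup>2)"
    by (intro AE_I2) (simp add: norm_mult)
qed

quotient_type 'n torus_L2 = "real ^ ('n::finite) \<Rightarrow> complex" / partial: L2_eq
  morphisms rep_L2 L2_class
proof (rule part_equivpI)
  show "\<exists>f::real ^ 'n \<Rightarrow> complex. L2_eq f f"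
    using square_integrable_zero by (auto simp: L2_eq_def)
  show "symp (L2_eq :: (real ^ 'n \<Rightarrow> complex) \<Rightarrow> _)"
    by (auto simp: symp_def L2_eq_def)
  show "transp (L2_eq :: (real ^ 'n \<Rightarrow> complex) \<Rightarrow> _)"
    unfolding transp_def L2_eq_def by (auto elim: AE_mp)
qed

lift_definition scaleC_L2 :: "complex \<Rightarrow> 'n::finite torus_L2 \<Rightarrow> 'n torus_L2"
  is "\<lambda>c f x. c * f x"
  by (auto simp: L2_eq_def square_integrable_cmult elim: AE_mp)

lift_definition cinner_L2 :: "'n::finite torus_L2 \<Rightarrow> 'n torus_L2 \<Rightarrow> complex"
  is "\<lambda>f g. LINT x|torus_measure. f x * cnj (g x)"
proof -
  fix f1 f2 g1 g2 :: "real ^ 'n \<Rightarrow> complex"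
  assume a: "L2_eq f1 f2" "L2_eq g1 g2"
  show "(LINT x|torus_measure. f1 x * cnj (g1 x)) = (LINT x|torus_measure. f2 x * cnj (g2 x))"
  proof (rule integral_cong_AE)
    show "AE x in torus_measure. f1 x * cnj (g1 x) = f2 x * cnj (g2 x)"
      using a unfolding L2_eq_def by auto
  qed (use a in \<open>auto simp: L2_eq_def intro!: borel_measurable_integrable square_integrable_prod\<close>)
qed

instantiation torus_L2 :: (finite) real_inner
begin

lift_definition zero_torus_L2 :: "'a torus_L2" is "\<lambda>_. 0"
  by (simp add: L2_eq_def square_integrable_zero)

lift_definition plus_torus_L2 :: "'a torus_L2 \<Rightarrow> 'a torus_L2 \<Rightarrow> 'a torus_L2"
  is "\<lambda>f g x. f x + g x"
  unfolding L2_eq_def by (auto intro: square_integrable_add)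

definition "uminus f = scaleC_L2 (-1) f" for f :: "'a torus_L2"
definition "f - g = f + (- g)" for f g :: "'a torus_L2"
definition "r *\<^sub>R f = scaleC_L2 (complex_of_real r) f" for f :: "'a torus_L2"
definition "f \<bullet> g = Re (cinner_L2 f g)" for f g :: "'a torus_L2"
definition "norm f = sqrt (f \<bullet> f)" for f :: "'a torus_L2"
definition "sgn f = scaleR (inverse (norm f)) f" for f :: "'a torus_L2"
definition "dist f g = norm (f - g)" for f g :: "'a torus_L2"
definition "uniformity = (INF e\<in>{0<..}. principal {(f :: 'a torus_L2, g). dist f g < e})"
definition "open U \<longleftrightarrow> (\<forall>f\<in>U. eventually (\<lambda>(f', g). f' = f \<longrightarrow> g \<in> U) uniformity)"
  for U :: "'a torus_L2 set"

lemma L2_add_assoc: "(f + g) + h = f + (g + h)" for f g h :: "'a torus_L2"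
  by transfer (auto simp: L2_eq_def add.assoc intro!: square_integrable_add)

lemma L2_add_commute: "f + g = g + f" for f g :: "'a torus_L2"
  by transfer (auto simp: L2_eq_def add.commute intro!: square_integrable_add)

lemma L2_add_zero: "0 + f = f" for f :: "'a torus_L2"
  by transfer simp

lemma L2_add_minus: "scaleC_L2 (-1) f + f = 0" for f :: "'a torus_L2"
  by transfer (auto simp: L2_eq_def square_integrable_zero)

lemma scaleC_L2_add_right: "scaleC_L2 c (f + g) = scaleC_L2 c f + scaleC_L2 c g"
  for f g :: "'a torus_L2"
  by transfer
    (auto simp: L2_eq_def distrib_left intro!: square_integrable_add square_integrable_cmult)

lemma scaleC_L2_add_left: "scaleC_L2 (c + d) f = scaleC_L2 c f + scaleC_L2 d f"
  for f :: "'a torus_L2"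
  by transfer
    (auto simp: L2_eq_def distrib_right intro!: square_integrable_add square_integrable_cmult)

lemma scaleC_L2_scaleC: "scaleC_L2 c (scaleC_L2 d f) = scaleC_L2 (c * d) f"
  for f :: "'a torus_L2"
  by transfer (auto simp: L2_eq_def mult.assoc intro!: square_integrable_cmult)

lemma scaleC_L2_one: "scaleC_L2 1 f = f" for f :: "'a torus_L2"
  by transfer simp

lemma cinner_L2_commute: "cinner_L2 f g = cnj (cinner_L2 g f)" for f g :: "'a torus_L2"
proof transfer
  fix f g :: "real ^ 'a \<Rightarrow> complex"
  have "cnj (LINT x|torus_measure. g x * cnj (f x)) = (LINT x|torus_measure. cnj (g x * cnj (f x)))"
    by (rule Bochner_Integration.integral_cnj[symmetric])
  then show "(LINT x|torus_measure. f x * cnj (g x)) = cnj (LINT x|torus_measure. g x * cnj (f x))"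
    by (simp add: mult.commute)
qed

lemma cinner_L2_add_left: "cinner_L2 (f + g) h = cinner_L2 f h + cinner_L2 g h"
  for f g h :: "'a torus_L2"
proof transfer
  fix f g h :: "real ^ 'a \<Rightarrow> complex"
  assume "L2_eq f f" "L2_eq g g" "L2_eq h h"
  then show "(LINT x|torus_measure. (f x + g x) * cnj (h x)) =
      (LINT x|torus_measure. f x * cnj (h x)) + (LINT x|torus_measure. g x * cnj (h x))"
    by (simp add: distrib_right L2_eq_def square_integrable_prod)
qed

lemma cinner_L2_scaleC_left: "cinner_L2 (scaleC_L2 c f) g = c * cinner_L2 f g"
  for f g :: "'a torus_L2"
  by transfer (simp add: mult.assoc)

lemma cinner_L2_self:
  fixes f :: "'a torus_L2"
  shows "0 \<le> Re (cinner_L2 f f)" "Re (cinner_L2 f f) = 0 \<longleftrightarrow> f = 0"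
proof -
  have eq: "(LINT x|torus_measure. g x * cnj (g x)) =
      complex_of_real (LINT x|torus_measure. (cmod (g x))\<^sup>2)" for g :: "real ^ 'a \<Rightarrow> complex"
    by (subst integral_complex_of_real[symmetric]) (simp only: complex_norm_square)
  show "0 \<le> Re (cinner_L2 f f)"
    by transfer (simp add: eq)
  show "Re (cinner_L2 f f) = 0 \<longleftrightarrow> f = 0"
  proof transfer
    fix g :: "real ^ 'a \<Rightarrow> complex"
    assume "L2_eq g g"
    then have g: "square_integrable g" by (simp add: L2_eq_def)
    then have "integrable torus_measure (\<lambda>x. (cmod (g x))\<^sup>2)"
      by (simp add: square_integrable_def)
    from integral_nonneg_eq_0_iff_AE[OF this]
    show "(Re (LINT x|torus_measure. g x * cnj (g x)) = 0) = L2_eq g (\<lambda>_. 0)"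
      using g by (simp add: eq L2_eq_def square_integrable_zero)
  qed
qed

instance
proof
  fix f g h :: "'a torus_L2" and r s :: real
  show "f + g + h = f + (g + h)" by (rule L2_add_assoc)
  show "f + g = g + f" by (rule L2_add_commute)
  show "0 + f = f" by (rule L2_add_zero)
  show "- f + f = 0" by (simp add: uminus_torus_L2_def L2_add_minus)
  show "f - g = f + - g" by (rule minus_torus_L2_def)
  show "r *\<^sub>R (f + g) = r *\<^sub>R f + r *\<^sub>R g"
    by (simp add: scaleR_torus_L2_def scaleC_L2_add_right)
  show "(r + s) *\<^sub>R f = r *\<^sub>R f + s *\<^sub>R f"
    by (simp add: scaleR_torus_L2_def scaleC_L2_add_left)
  show "r *\<^sub>R s *\<^sub>R f = (r * s) *\<^sub>R f"
    by (simp add: scaleR_torus_L2_def scaleC_L2_scaleC)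
  show "1 *\<^sub>R f = f" by (simp add: scaleR_torus_L2_def scaleC_L2_one)
  show "dist f g = norm (f - g)" by (rule dist_torus_L2_def)
  show "sgn f = scaleR (inverse (norm f)) f" by (rule sgn_torus_L2_def)
  show "f \<bullet> g = g \<bullet> f"
    unfolding inner_torus_L2_def by (subst cinner_L2_commute) simp
  show "(f + g) \<bullet> h = f \<bullet> h + g \<bullet> h"
    by (simp add: inner_torus_L2_def cinner_L2_add_left)
  show "r *\<^sub>R f \<bullet> g = r * (f \<bullet> g)"
    by (simp add: inner_torus_L2_def scaleR_torus_L2_def cinner_L2_scaleC_left)
  show "0 \<le> f \<bullet> f" by (simp add: inner_torus_L2_def cinner_L2_self)
  show "f \<bullet> f = 0 \<longleftrightarrow> f = 0" by (simp add: inner_torus_L2_def cinner_L2_self)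
  show "norm f = sqrt (f \<bullet> f)" by (rule norm_torus_L2_def)
next
  show "uniformity = (INF e\<in>{0<..}. principal {(f :: 'a torus_L2, g). dist f g < e})"
    by (rule uniformity_torus_L2_def)
next
  fix U :: "'a torus_L2 set"
  show "open U \<longleftrightarrow> (\<forall>f\<in>U. \<forall>\<^sub>F (f', g) in uniformity. f' = f \<longrightarrow> g \<in> U)"
    by (rule open_torus_L2_def)
qed

end

global_interpretation L2: vector_space "scaleC_L2 :: complex \<Rightarrow> 'n::finite torus_L2 \<Rightarrow> 'n torus_L2"
  defines L2_dim = L2.dim
  by unfold_locales
    (simp_all add: scaleC_L2_add_right scaleC_L2_add_left scaleC_L2_scaleC scaleC_L2_one)


section \<open>Schatten classes\<close>

definition bounded_clinear_L2 :: "('n::finite torus_L2 \<Rightarrow> 'n torus_L2) \<Rightarrow> bool" where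
  "bounded_clinear_L2 T \<longleftrightarrow> bounded_linear T \<and> (\<forall>c f. T (scaleC_L2 c f) = scaleC_L2 c (T f))"

definition compact_operator_L2 :: "('n::finite torus_L2 \<Rightarrow> 'n torus_L2) \<Rightarrow> bool" where
  "compact_operator_L2 T \<longleftrightarrow> bounded_clinear_L2 T \<and> compact (closure (T ` cball 0 1))"

definition is_adjoint_L2 ::
  "('n::finite torus_L2 \<Rightarrow> 'n torus_L2) \<Rightarrow> ('n torus_L2 \<Rightarrow> 'n torus_L2) \<Rightarrow> bool" where
  "is_adjoint_L2 T T' \<longleftrightarrow> bounded_clinear_L2 T' \<and>
     (\<forall>f g. cinner_L2 (T f) g = cinner_L2 f (T' g))"

definition positive_operator_L2 :: "('n::finite torus_L2 \<Rightarrow> 'n torus_L2) \<Rightarrow> bool" where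
  "positive_operator_L2 S \<longleftrightarrow> bounded_clinear_L2 S \<and>
     (\<forall>f. cinner_L2 (S f) f \<in> \<real> \<and> Re (cinner_L2 (S f) f) \<ge> 0)"

text \<open>
  \<open>is_abs_L2 T S\<close> says that \<open>S = sqrt (T\<^sup>* T)\<close>: the adjoint of a bounded operator and the positive
  square root of a positive operator exist and are unique.
\<close>

definition is_abs_L2 ::
  "('n::finite torus_L2 \<Rightarrow> 'n torus_L2) \<Rightarrow> ('n torus_L2 \<Rightarrow> 'n torus_L2) \<Rightarrow> bool" where
  "is_abs_L2 T S \<longleftrightarrow> positive_operator_L2 S \<and> (\<exists>T'. is_adjoint_L2 T T' \<and> S \<circ> S = T' \<circ> T)"

definition eigenspace_L2 ::
  "('n::finite torus_L2 \<Rightarrow> 'n torus_L2) \<Rightarrow> real \<Rightarrow> 'n torus_L2 set" where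
  "eigenspace_L2 S \<mu> = {f. S f = scaleC_L2 (of_real \<mu>) f}"

text \<open>
  The sequence of singular values of a compact \<open>T\<close>: it lists every eigenvalue \<open>\<mu> > 0\<close> of \<open>sqrt (T\<^sup>* T)\<close>
  as often as its multiplicity, which is finite, and its other entries are \<open>0\<close>.
  The order of the entries and the number of zeros are left open, as neither affects
  membership in \<open>\<ell>\<^sup>r\<close>.
\<close>

definition singular_values_L2 ::
  "('n::finite torus_L2 \<Rightarrow> 'n torus_L2) \<Rightarrow> (nat \<Rightarrow> real) \<Rightarrow> bool" where
  "singular_values_L2 T s \<longleftrightarrow> (\<forall>k. 0 \<le> s k) \<and>
     (\<exists>S. is_abs_L2 T S \<and>
       (\<forall>\<mu>>0. finite {k. s k = \<mu>} \<and> card {k. s k = \<mu>} = L2_dim (eigenspace_L2 S \<mu>)))"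

definition Schatten_L2 :: "real \<Rightarrow> ('n::finite torus_L2 \<Rightarrow> 'n torus_L2) set" where
  "Schatten_L2 r = {T. compact_operator_L2 T \<and>
     (\<exists>s. singular_values_L2 T s \<and> summable (\<lambda>k. s k powr r))}"

text \<open>An operator on smooth functions is identified with its bounded extension to \<open>L\<^sup>2\<close>.\<close>

definition L2_extension ::
  "((real ^ 'n \<Rightarrow> complex) \<Rightarrow> (real ^ 'n \<Rightarrow> complex)) \<Rightarrow> ('n::finite torus_L2 \<Rightarrow> 'n torus_L2) \<Rightarrow> bool"
  where "L2_extension A T \<longleftrightarrow> bounded_clinear_L2 T \<and>
    (\<forall>f. torus_smooth f \<longrightarrow> square_integrable (A f) \<and> T (L2_class f) = L2_class (A f))"

end

theory Submission
  imports Defs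
begin

text \<open>
  The \<open>(0, 0)\<close> calculus asks for no decay of differences in \<open>\<xi>\<close>, and the weight \<open>\<langle>\<xi>\<rangle>\<close> varies slowly,
  so cutting the symbol \<open>\<langle>\<xi>\<rangle> powr (- \<kappa>)\<close> off to an arbitrary set of frequencies leaves it in the
  class of order \<open>- \<kappa>\<close>. Take a lacunary sequence of frequencies, \<open>2 ^ k\<close> in one coordinate direction.
  An operator determines its symbol (test it on characters), whose size on the sequence
  fixes the order and which vanishes off the sequence, so ellipticity fails. The operator is diagonal
  in the characters and positive, hence equal to its absolute value, and its singular
  values decay geometrically. It is compact because it maps the unit ball into a continuous image of
  a product of discs, the possible sequences of Fourier coefficients; this avoids completeness
  of the space of square integrable functions.
\<close>

section \<open>Characters\<close>

lemma torus_char_altdef: "torus_char \<xi> x = cis (2 * pi * (x \<bullet> lattice_vec \<xi>))"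
  by (simp add: torus_char_def cis_conv_exp mult_ac)

lemma lattice_vec_inner_axis: "lattice_vec \<xi> \<bullet> axis j 1 = of_int (\<xi> $ j)"
  by (simp add: lattice_vec_def inner_axis)

lemma norm_torus_char [simp]: "cmod (torus_char \<xi> x) = 1"
  by (simp add: torus_char_altdef)

lemma torus_fun_torus_char: "torus_fun (torus_char \<xi>)"
proof -
  have "torus_char \<xi> (x + lattice_vec k) = torus_char \<xi> x" for x k
  proof -
    have "lattice_vec k \<bullet> lattice_vec \<xi> = of_int (\<Sum>i\<in>UNIV. k $ i * \<xi> $ i)"
      by (simp add: lattice_vec_def inner_vec_def)
    then have "cis (2 * pi * (lattice_vec k \<bullet> lattice_vec \<xi>)) = 1"
      using cis_multiple_2pi[of "lattice_vec k \<bullet> lattice_vec \<xi>"] by (simp del: of_int_sum of_int_mult)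
    then show ?thesis
      by (simp add: torus_char_altdef inner_add_left distrib_left flip: cis_mult)
  qed
  then show ?thesis by (simp add: torus_fun_def)
qed

lemma continuous_torus_char: "continuous_on UNIV (torus_char \<xi>)"
  unfolding torus_char_def by (intro continuous_intros)

section \<open>The normalised measure of the torus and orthonormality of the characters\<close>

lemma space_torus_measure: "space (torus_measure :: (real ^ 'n) measure) = cbox 0 1"
  by (simp add: torus_measure_def space_restrict_space)

lemma measure_torus_measure [simp]: "measure torus_measure (cbox 0 1 :: (real ^ 'n) set) = 1"
proof -
  have "measure torus_measure (cbox 0 1 :: (real ^ 'n) set) = measure lborel (cbox 0 1 :: (real ^ 'n) set)"
    unfolding torus_measure_def by (subst measure_restrict_space) auto
  also have "\<dots> = (\<Prod>b\<in>(Basis :: (real ^ 'n) set). (1 - 0) \<bullet> b)"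
    by (rule measure_lborel_cbox) (auto simp: Basis_vec_def inner_axis)
  also have "\<dots> = 1"
    by (intro prod.neutral) (auto simp: Basis_vec_def inner_axis)
  finally show ?thesis .
qed

lemma finite_measure_torus_measure: "finite_measure (torus_measure :: (real ^ 'n) measure)"
proof (rule finite_measureI)
  show "emeasure torus_measure (space (torus_measure :: (real ^ 'n) measure)) \<noteq> \<infinity>"
    unfolding space_torus_measure torus_measure_def by (subst emeasure_restrict_space)
    (use emeasure_lborel_cbox_finite[of 0 "1 :: real ^ 'n"] in auto)
qed

lemma integral_char_unit_interval:
  "(LINT t|lborel. indicator {0..1} t *\<^sub>R cis (2 * pi * (t * of_int k))) = (if k = 0 then 1 else 0)"
proof (cases "k = 0")
  case True
  have "(LINT t|lborel. indicator {0..1} (t :: real) *\<^sub>R (1::complex)) = of_real 1 - of_real 0"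
    by (rule integral_FTC_Icc[where F = complex_of_real])
      (auto simp: has_vector_derivative_def scaleR_conv_of_real
        intro!: bounded_linear_imp_has_derivative bounded_linear_of_real)
  with True show ?thesis by simp
next
  case False
  define c where "c = 2 * pi * of_int k"
  have c: "c \<noteq> 0" using False by (simp add: c_def)
  have "(LINT t|lborel. indicator {0..1} t *\<^sub>R cis (c * t))
      = cis (c * 1) / (\<i> * of_real c) - cis (c * 0) / (\<i> * of_real c)"
  proof (rule integral_FTC_Icc)
    fix t :: real
    have "((\<lambda>z. exp (\<i> * of_real c * z) / (\<i> * of_real c)) has_field_derivative exp (\<i> * of_real c * of_real t))
        (at (of_real t))"
      using c by (auto intro!: derivative_eq_intros)
    then show "((\<lambda>t. cis (c * t) / (\<i> * of_real c)) has_vector_derivative cis (c * t)) (at t within {0..1})"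
      using has_vector_derivative_real_field by (fastforce simp: cis_conv_exp mult.assoc)
  qed (auto simp: cis_conv_exp intro!: continuous_intros)
  moreover have "cis c = 1"
    using cis_multiple_2pi[of "of_int k"] by (simp add: c_def)
  ultimately show ?thesis using False by (simp add: c_def mult_ac)
qed

text \<open>A character is a product of exponentials in one coordinate each, so by Fubini its
  integral is the product of the integrals over \<open>{0..1}\<close>. A single nonzero coordinate
  of \<open>\<xi>\<close> makes the product vanish.\<close>

lemma integral_torus_char:
  "(LINT x|torus_measure. torus_char \<xi> (x :: real ^ 'n)) = (if \<xi> = 0 then 1 else 0)"
proof -
  define g :: "real ^ 'n \<Rightarrow> real \<Rightarrow> complex" where
    "g b t = indicator {0..1} t *\<^sub>R cis (2 * pi * (t * (lattice_vec \<xi> \<bullet> b)))" for b t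
  interpret product_sigma_finite "\<lambda>_ :: real ^ 'n. lborel :: real measure" ..
  have g_meas [measurable]: "g b \<in> borel_measurable borel" for b
  proof -
    have "(\<lambda>t. cis (2 * pi * (t * (lattice_vec \<xi> \<bullet> b)))) \<in> borel_measurable borel"
      unfolding cis_conv_exp by (intro borel_measurable_continuous_onI continuous_intros)
    then show ?thesis unfolding g_def by measurable
  qed
  have g: "(LINT t|lborel. g (axis j 1) t) = (if \<xi> $ j = 0 then 1 else 0)" for j
    using integral_char_unit_interval by (simp add: g_def lattice_vec_inner_axis)
  have fin: "finite (Basis :: (real ^ 'n) set)" by simp
  have int: "integrable lborel (g b)" for b
    unfolding g_def
    by (auto simp: cis_conv_exp intro!: borel_integrable_atLeastAtMost'[unfolded set_integrable_def]
        continuous_intros)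
  have "indicator (cbox 0 1) x *\<^sub>R torus_char \<xi> x = (\<Prod>b\<in>Basis. g b (x \<bullet> b))" for x :: "real ^ 'n"
  proof -
    have ind: "(\<Prod>b\<in>Basis. indicator {0..1} (x \<bullet> b)) = (indicator (cbox 0 1) x :: real)"
      by (auto simp: indicator_def mem_box Basis_vec_def inner_axis intro!: prod.neutral)
    have "cis (\<Sum>b\<in>B. h b) = (\<Prod>b\<in>B. cis (h b))" if "finite B" for B and h :: "real ^ 'n \<Rightarrow> real"
      using that by induction (auto simp flip: cis_mult)
    then have "torus_char \<xi> x = (\<Prod>b\<in>Basis. cis (2 * pi * ((x \<bullet> b) * (lattice_vec \<xi> \<bullet> b))))"
      unfolding torus_char_altdef
      by (subst euclidean_inner) (simp add: sum_distrib_left)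
    then show ?thesis
      by (simp add: g_def scaleR_conv_of_real prod.distrib flip: ind)
  qed
  then have "(LINT x|torus_measure. torus_char \<xi> (x :: real ^ 'n)) = (LINT x|lborel. (\<Prod>b\<in>Basis. g b ((x :: real ^ 'n) \<bullet> b)))"
    unfolding torus_measure_def by (subst integral_restrict_space) auto
  \<comment> \<open>Lebesgue measure is the image of a product of one-dimensional ones, which
    prepares for Fubini.\<close>
  also have "\<dots> = (LINT f|(\<Pi>\<^sub>M b\<in>Basis. lborel). (\<Prod>b\<in>Basis. g b ((\<Sum>b\<in>Basis. f b *\<^sub>R b :: real ^ 'n) \<bullet> b)))"
    by (subst lborel_eq, subst integral_distr) auto
  also have "\<dots> = (LINT f|(\<Pi>\<^sub>M b\<in>Basis. lborel). (\<Prod>b\<in>(Basis :: (real ^ 'n) set). g b (f b)))"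
    by (intro Bochner_Integration.integral_cong refl prod.cong) simp
  also have "\<dots> = (\<Prod>b\<in>(Basis :: (real ^ 'n) set). LINT t|lborel. g b t)"
    by (rule product_integral_prod[OF fin int])
  also have "\<dots> = (\<Prod>j\<in>(UNIV :: 'n set). LINT t|lborel. g (axis j 1) t)"
  proof -
    have Basis: "(Basis :: (real ^ 'n) set) = (\<lambda>j. axis j 1) ` UNIV" by (auto simp: Basis_vec_def)
    have "inj (\<lambda>j. axis j 1 :: real ^ 'n)" by (simp add: inj_on_def axis_eq_axis)
    then show ?thesis unfolding Basis by (subst prod.reindex) (auto simp: o_def)
  qed
  also have "\<dots> = (if \<xi> = 0 then 1 else 0)"
    by (auto simp: g vec_eq_iff)
  finally show ?thesis .
qed

lemma torus_char_mult_cnj: "torus_char \<xi> x * cnj (torus_char \<eta> x) = torus_char (\<xi> - \<eta>) x"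
proof -
  have "lattice_vec (\<xi> - \<eta>) = lattice_vec \<xi> - lattice_vec \<eta>"
    by (simp add: lattice_vec_def vec_eq_iff)
  then show ?thesis
    by (simp add: torus_char_altdef cis_cnj cis_mult inner_diff_right right_diff_distrib)
qed

lemma fourier_coeff_torus_char: "fourier_coeff (torus_char \<xi>) \<eta> = (if \<xi> = \<eta> then 1 else 0)"
  by (simp add: fourier_coeff_def torus_char_mult_cnj integral_torus_char)

section \<open>The space of square integrable functions\<close>

lemma L2_class_eqs:
  assumes "square_integrable f" "square_integrable g"
  shows cinner_L2_class: "cinner_L2 (L2_class f) (L2_class g) = (LINT x|torus_measure. f x * cnj (g x))"
    and add_L2_class: "L2_class f + L2_class g = L2_class (\<lambda>x. f x + g x)"
    and scaleC_L2_class: "scaleC_L2 c (L2_class f) = L2_class (\<lambda>x. c * f x)"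
proof -
  have "L2_eq f f" "L2_eq g g" using assms by (auto simp: L2_eq_def)
  then show "cinner_L2 (L2_class f) (L2_class g) = (LINT x|torus_measure. f x * cnj (g x))"
    "L2_class f + L2_class g = L2_class (\<lambda>x. f x + g x)"
    "scaleC_L2 c (L2_class f) = L2_class (\<lambda>x. c * f x)"
    by (auto simp: cinner_L2.abs_eq plus_torus_L2.abs_eq scaleC_L2.abs_eq)
qed

text \<open>The measure lives on the unit cube and has total mass 1, so a bound on the cube alone
  already bounds the norm in the space of square integrable functions.\<close>

lemma square_integrable_bounded:
  fixes f :: "real ^ 'n \<Rightarrow> complex"
  assumes "torus_fun f" "continuous_on UNIV f" and le: "\<And>x. x \<in> cbox 0 1 \<Longrightarrow> cmod (f x) \<le> B"
  shows "square_integrable f" and "norm (L2_class f) \<le> B"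
proof -
  interpret finite_measure "torus_measure :: (real ^ 'n) measure" by (rule finite_measure_torus_measure)
  have meas: "f \<in> borel_measurable borel"
    using assms(2) by (rule borel_measurable_continuous_onI)
  then have meas2: "(\<lambda>x. (cmod (f x))\<^sup>2) \<in> borel_measurable torus_measure"
    by (intro measurable_torus_measure) measurable
  have "0 \<le> cmod (f 0)" by simp
  also have "\<dots> \<le> B" by (rule le) (auto simp: mem_box Basis_vec_def inner_axis)
  finally have "0 \<le> B" .
  have le2: "AE x in torus_measure. (cmod (f x))\<^sup>2 \<le> B\<^sup>2"
    by (rule AE_I2) (use le in \<open>auto simp: space_torus_measure intro!: power_mono\<close>)
  have int: "integrable torus_measure (\<lambda>x. (cmod (f x))\<^sup>2)"
    using le2 by (intro integrable_const_bound[OF _ meas2, of "B\<^sup>2"]) auto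
  show si: "square_integrable f"
    using assms(1) meas int by (simp add: square_integrable_def)
  have eq: "cinner_L2 (L2_class f) (L2_class f) = complex_of_real (LINT x|torus_measure. (cmod (f x))\<^sup>2)"
    unfolding cinner_L2_class[OF si si]
    by (subst integral_complex_of_real[symmetric]) (simp only: complex_norm_square)
  have "(LINT x|torus_measure. (cmod (f x))\<^sup>2) \<le> (LINT x|(torus_measure :: (real ^ 'n) measure). B\<^sup>2)"
    by (rule integral_mono_AE[OF int _ le2]) simp
  then show "norm (L2_class f) \<le> B"
    using \<open>0 \<le> B\<close> by (auto simp: norm_torus_L2_def inner_torus_L2_def eq space_torus_measure intro!: real_le_lsqrt)
qed

lemma square_integrable_continuous:
  assumes "torus_fun f" "continuous_on UNIV f"
  shows "square_integrable f"
proof -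
  have "compact (f ` cbox 0 1)"
    by (intro compact_continuous_image continuous_on_subset[OF assms(2)]) auto
  then obtain B where "\<And>x. x \<in> cbox 0 1 \<Longrightarrow> cmod (f x) \<le> B"
    by (meson bounded_iff compact_imp_bounded imageI)
  with assms show ?thesis by (rule square_integrable_bounded)
qed

lemma torus_smooth_imp_square_integrable: "torus_smooth f \<Longrightarrow> square_integrable f"
proof -
  assume f: "torus_smooth f"
  then have "continuous_on UNIV (partial_derivs [] f)" unfolding torus_smooth_def by blast
  with f show ?thesis by (intro square_integrable_continuous) (simp_all add: torus_smooth_def)
qed

section \<open>Complex scalars and the Cauchy-Schwarz inequality\<close>

lemma norm_scaleC_L2: "norm (scaleC_L2 c f) = cmod c * norm f"
proof -
  have "cinner_L2 (scaleC_L2 c f) (scaleC_L2 c f) = c * cnj c * cinner_L2 f f"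
    by (metis cinner_L2_commute cinner_L2_scaleC_left complex_cnj_mult mult.assoc)
  also have "c * cnj c = complex_of_real ((cmod c)\<^sup>2)" by (simp only: complex_norm_square)
  finally show ?thesis
    by (simp add: norm_torus_L2_def inner_torus_L2_def real_sqrt_mult)
qed

text \<open>The inner product of the type class is only the real part of \<open>cinner_L2\<close>.
  Multiplying \<open>f\<close> by a phase makes \<open>cinner_L2 f g\<close> real and nonnegative,
  and then the real Cauchy-Schwarz inequality applies.\<close>

lemma cmod_cinner_L2_le: "cmod (cinner_L2 f g) \<le> norm f * norm g"
proof (cases "cinner_L2 f g = 0")
  case False
  define z where "z = cinner_L2 f g"
  define c where "c = cnj z / of_real (cmod z)"
  have z: "z \<noteq> 0" using False by (simp add: z_def)
  have "cmod c = 1" using z by (simp add: c_def norm_divide)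
  have "c * z = (z * cnj z) / of_real (cmod z)" by (simp add: c_def)
  also have "\<dots> = of_real ((cmod z)\<^sup>2) / of_real (cmod z)" by (simp only: complex_norm_square)
  also have "\<dots> = of_real (cmod z)" using z by (simp add: power2_eq_square)
  finally have "c * z = of_real (cmod z)" .
  then have "cmod z = scaleC_L2 c f \<bullet> g"
    by (simp add: inner_torus_L2_def cinner_L2_scaleC_left z_def)
  also have "\<dots> \<le> norm f * norm g"
    using norm_cauchy_schwarz[of "scaleC_L2 c f" g] \<open>cmod c = 1\<close> by (simp add: norm_scaleC_L2)
  finally show ?thesis by (simp add: z_def)
qed simp

lemma scaleC_L2_scaleR: "scaleC_L2 c (r *\<^sub>R f) = r *\<^sub>R scaleC_L2 c f"
  by (simp add: scaleR_torus_L2_def scaleC_L2_scaleC mult.commute)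

lemma bounded_linear_cinner_L2_left: "bounded_linear (\<lambda>f. cinner_L2 f g)"
  by (rule bounded_linear_intro[where K = "norm g"])
    (auto simp: cinner_L2_add_left scaleR_torus_L2_def cinner_L2_scaleC_left cmod_cinner_L2_le
      scaleR_conv_of_real)

lemma bounded_linear_scaleC_L2: "bounded_linear (scaleC_L2 c)"
  by (rule bounded_linear_intro[where K = "cmod c"])
    (auto simp: scaleC_L2_add_right scaleC_L2_scaleR norm_scaleC_L2 mult.commute)

lemma bounded_linear_scaleC_L2_left: "bounded_linear (\<lambda>c. scaleC_L2 c f)"
  by (rule bounded_linear_intro[where K = "norm f"])
    (auto simp: scaleC_L2_add_left scaleR_torus_L2_def scaleC_L2_scaleC norm_scaleC_L2
      scaleR_conv_of_real)

section \<open>The characters as an orthonormal system\<close>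

definition char_L2 :: "int ^ 'n::finite \<Rightarrow> 'n torus_L2" where
  "char_L2 \<xi> = L2_class (torus_char \<xi>)"

lemma square_integrable_torus_char: "square_integrable (torus_char \<xi>)"
  by (intro square_integrable_continuous torus_fun_torus_char continuous_torus_char)

lemma cinner_char_L2: "cinner_L2 (char_L2 \<xi>) (char_L2 \<eta>) = (if \<xi> = \<eta> then 1 else 0)"
  by (simp add: char_L2_def cinner_L2_class square_integrable_torus_char torus_char_mult_cnj
      integral_torus_char)

lemma norm_char_L2 [simp]: "norm (char_L2 \<xi>) = 1"
  by (simp add: norm_torus_L2_def inner_torus_L2_def cinner_char_L2)

lemma fourier_coeff_eq_cinner:
  "square_integrable f \<Longrightarrow> fourier_coeff f \<xi> = cinner_L2 (L2_class f) (char_L2 \<xi>)"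
  by (simp add: fourier_coeff_def char_L2_def cinner_L2_class square_integrable_torus_char)

lemma cmod_cinner_char_L2_le: "cmod (cinner_L2 f (char_L2 \<xi>)) \<le> norm f"
  using cmod_cinner_L2_le[of f "char_L2 \<xi>"] by simp

section \<open>Absolutely convergent Fourier series\<close>

text \<open>The series is summed pointwise, as a function on the torus. Its class is therefore an
  explicit candidate for the limit of the partial sums in norm.\<close>

definition fourier_series :: "(nat \<Rightarrow> int ^ 'n) \<Rightarrow> (nat \<Rightarrow> complex) \<Rightarrow> real ^ 'n \<Rightarrow> complex" where
  "fourier_series \<xi> u x = (\<Sum>k. u k * torus_char (\<xi> k) x)"

text \<open>By the Weierstrass test the series converges uniformly, so its sum is continuous. The
  bound of the norm comes from the supremum; it is crude, but it tends to 0 along the tails.\<close>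

lemma fourier_series_props:
  fixes \<xi> :: "nat \<Rightarrow> int ^ 'n"
  assumes "summable (\<lambda>k. cmod (u k))"
  shows square_integrable_fourier_series: "square_integrable (fourier_series \<xi> u)"
    and norm_fourier_series_le: "norm (L2_class (fourier_series \<xi> u)) \<le> (\<Sum>k. cmod (u k))"
proof -
  have per: "torus_fun (fourier_series \<xi> u)"
  proof -
    have "torus_char (\<xi> k) (x + lattice_vec l) = torus_char (\<xi> k) x" for k l x
      using torus_fun_torus_char[of "\<xi> k"] by (simp add: torus_fun_def)
    then show ?thesis by (simp add: torus_fun_def fourier_series_def)
  qed
  have "uniform_limit UNIV (\<lambda>N x. \<Sum>k<N. u k * torus_char (\<xi> k) x) (fourier_series \<xi> u) sequentially"
    unfolding fourier_series_def [abs_def] using assms by (intro Weierstrass_m_test) (auto simp: norm_mult)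
  then have cont: "continuous_on UNIV (fourier_series \<xi> u)"
    by (rule uniform_limit_theorem[rotated])
      (auto intro!: always_eventually continuous_intros continuous_torus_char)
  have le: "cmod (fourier_series \<xi> u x) \<le> (\<Sum>k. cmod (u k))" for x
    unfolding fourier_series_def
    using summable_norm[of "\<lambda>k. u k * torus_char (\<xi> k) x"] assms by (simp add: norm_mult)
  show "square_integrable (fourier_series \<xi> u)"
    "norm (L2_class (fourier_series \<xi> u)) \<le> (\<Sum>k. cmod (u k))"
    by (rule square_integrable_bounded[OF per cont le])+
qed

text \<open>The remainder after \<open>N\<close> terms is again a Fourier series, with shifted
  frequencies and coefficients, so the norm bound for such series applies to it.\<close>

lemma fourier_series_split:
  assumes "summable (\<lambda>k. cmod (u k))"
  shows "L2_class (fourier_series \<xi> u) =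
    (\<Sum>k<N. scaleC_L2 (u k) (char_L2 (\<xi> k))) + L2_class (fourier_series (\<lambda>k. \<xi> (k + N)) (\<lambda>k. u (k + N)))"
proof (induction N)
  case (Suc N)
  define \<xi>' u' where "\<xi>' = (\<lambda>k. \<xi> (k + Suc N))" and "u' = (\<lambda>k. u (k + Suc N))"
  have sm: "summable (\<lambda>k. cmod (u' k))"
    unfolding u'_def using assms by (rule summable_ignore_initial_segment)
  have eq: "fourier_series (\<lambda>k. \<xi> (k + N)) (\<lambda>k. u (k + N))
      = (\<lambda>x. u N * torus_char (\<xi> N) x + fourier_series \<xi>' u' x)"
  proof
    fix x
    have "summable (\<lambda>k. u (k + N) * torus_char (\<xi> (k + N)) x)"
      using summable_ignore_initial_segment[OF assms, of N]
      by (intro summable_norm_cancel[of "\<lambda>k. u (k + N) * torus_char (\<xi> (k + N)) x"]) (simp add: norm_mult)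
    from suminf_split_head[OF this]
    show "fourier_series (\<lambda>k. \<xi> (k + N)) (\<lambda>k. u (k + N)) x
        = u N * torus_char (\<xi> N) x + fourier_series \<xi>' u' x"
      by (simp add: fourier_series_def \<xi>'_def u'_def)
  qed
  have "L2_class (fourier_series (\<lambda>k. \<xi> (k + N)) (\<lambda>k. u (k + N)))
      = scaleC_L2 (u N) (char_L2 (\<xi> N)) + L2_class (fourier_series \<xi>' u')"
    unfolding char_L2_def eq scaleC_L2_class[OF square_integrable_torus_char square_integrable_torus_char]
    by (intro add_L2_class [symmetric] square_integrable_torus_char square_integrable_cmult
        square_integrable_fourier_series sm)
  with Suc show ?case by (simp add: \<xi>'_def u'_def add.assoc)
qed simp

lemma norm_fourier_series_minus_partial_sum_le:
  assumes "summable (\<lambda>k. cmod (u k))"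
  shows "norm (L2_class (fourier_series \<xi> u) - (\<Sum>k<N. scaleC_L2 (u k) (char_L2 (\<xi> k))))
    \<le> (\<Sum>k. cmod (u (k + N)))"
  using norm_fourier_series_le[OF summable_ignore_initial_segment[OF assms, of N]]
  by (simp add: fourier_series_split[OF assms, of \<xi> N])

lemma suminf_tail_tendsto_0:
  fixes a :: "nat \<Rightarrow> real"
  assumes "summable a"
  shows "(\<lambda>N. \<Sum>k. a (k + N)) \<longlonglongrightarrow> 0"
proof -
  have "(\<lambda>N. suminf a - (\<Sum>k<N. a k)) \<longlonglongrightarrow> suminf a - suminf a"
    by (intro tendsto_intros summable_LIMSEQ assms)
  then show ?thesis by (simp add: suminf_minus_initial_segment[OF assms])
qed

text \<open>The pointwise sum is also the sum in norm, since its distance to the partial sums is at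
  most a tail of a convergent series. This lets bounded linear maps act term by term.\<close>

lemma fourier_series_sums:
  assumes "summable (\<lambda>k. cmod (u k))"
  shows "(\<lambda>k. scaleC_L2 (u k) (char_L2 (\<xi> k))) sums L2_class (fourier_series \<xi> u)"
proof -
  have "(\<lambda>N. L2_class (fourier_series \<xi> u) - (\<Sum>k<N. scaleC_L2 (u k) (char_L2 (\<xi> k)))) \<longlonglongrightarrow> 0"
    by (rule Lim_null_comparison[OF _ suminf_tail_tendsto_0[OF assms]])
      (intro always_eventually allI norm_fourier_series_minus_partial_sum_le assms)
  from tendsto_diff[OF tendsto_const this, of "L2_class (fourier_series \<xi> u)"]
  show ?thesis by (simp add: sums_def)
qed

section \<open>Multipliers supported on a sequence of frequencies\<close>

text \<open>For summable positive \<open>w\<close> and injective \<open>\<xi>\<close> this is the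
  diagonal operator with eigenvalue \<open>w k\<close> on the character of frequency
  \<open>\<xi> k\<close> and 0 on all other characters.\<close>

definition multiplier_L2 :: "(nat \<Rightarrow> int ^ 'n::finite) \<Rightarrow> (nat \<Rightarrow> real) \<Rightarrow> 'n torus_L2 \<Rightarrow> 'n torus_L2" where
  "multiplier_L2 \<xi> w f =
    L2_class (fourier_series \<xi> (\<lambda>k. of_real (w k) * cinner_L2 f (char_L2 (\<xi> k))))"

lemma summable_mult_bounded:
  assumes "summable w" "\<And>k. 0 \<le> w k" "\<And>k. cmod (c k) \<le> B"
  shows "summable (\<lambda>k. cmod (of_real (w k) * c k))"
proof (rule summable_comparison_test)
  show "\<exists>N. \<forall>k\<ge>N. norm (cmod (complex_of_real (w k) * c k)) \<le> w k * B"
    using assms by (auto simp: norm_mult intro!: mult_left_mono)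
qed (intro summable_mult2 assms)

context
  fixes \<xi> :: "nat \<Rightarrow> int ^ 'n::finite" and w :: "nat \<Rightarrow> real"
  assumes w: "summable w" "\<And>k. 0 < w k"
begin

lemma summable_multiplier: "summable (\<lambda>k. cmod (of_real (w k) * cinner_L2 f (char_L2 (\<xi> k))))"
  using w by (intro summable_mult_bounded[where B = "norm f"] cmod_cinner_char_L2_le less_imp_le)

lemma multiplier_L2_sums:
  "(\<lambda>k. scaleC_L2 (of_real (w k) * cinner_L2 f (char_L2 (\<xi> k))) (char_L2 (\<xi> k))) sums multiplier_L2 \<xi> w f"
  unfolding multiplier_L2_def by (intro fourier_series_sums summable_multiplier)

lemma norm_multiplier_L2_le: "norm (multiplier_L2 \<xi> w f) \<le> norm f * suminf w"
proof -
  have "norm (multiplier_L2 \<xi> w f) \<le> (\<Sum>k. cmod (of_real (w k) * cinner_L2 f (char_L2 (\<xi> k))))"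
    unfolding multiplier_L2_def by (intro norm_fourier_series_le summable_multiplier)
  also have "\<dots> \<le> (\<Sum>k. norm f * w k)"
    using w by (intro suminf_le summable_multiplier summable_mult)
      (auto simp: norm_mult mult.commute[of "norm f"] abs_of_pos intro!: mult_left_mono cmod_cinner_char_L2_le less_imp_le)
  also have "\<dots> = norm f * suminf w" using w by (simp add: suminf_mult)
  finally show ?thesis .
qed

text \<open>Linearity is checked on the terms of the expansion and passes to the sum by uniqueness
  of limits.\<close>

lemma multiplier_L2_add: "multiplier_L2 \<xi> w (f + g) = multiplier_L2 \<xi> w f + multiplier_L2 \<xi> w g"
  by (rule sums_unique2[OF multiplier_L2_sums])
    (use sums_add[OF multiplier_L2_sums multiplier_L2_sums, of f g] in
      \<open>simp add: cinner_L2_add_left distrib_left scaleC_L2_add_left\<close>)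

lemma multiplier_L2_scaleC: "multiplier_L2 \<xi> w (scaleC_L2 c f) = scaleC_L2 c (multiplier_L2 \<xi> w f)"
  by (rule sums_unique2[OF multiplier_L2_sums])
    (use bounded_linear.sums[OF bounded_linear_scaleC_L2 multiplier_L2_sums, of c f] in
      \<open>simp add: cinner_L2_scaleC_left scaleC_L2_scaleC mult_ac\<close>)

lemma bounded_clinear_multiplier_L2: "bounded_clinear_L2 (multiplier_L2 \<xi> w)"
  unfolding bounded_clinear_L2_def
proof
  show "bounded_linear (multiplier_L2 \<xi> w)"
    by (rule bounded_linear_intro[OF multiplier_L2_add _ norm_multiplier_L2_le])
      (simp add: scaleR_torus_L2_def multiplier_L2_scaleC)
qed (simp add: multiplier_L2_scaleC)

lemma cinner_multiplier_L2_sums: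
  "(\<lambda>k. of_real (w k) * cinner_L2 f (char_L2 (\<xi> k)) * cinner_L2 (char_L2 (\<xi> k)) g)
    sums cinner_L2 (multiplier_L2 \<xi> w f) g"
  using bounded_linear.sums[OF bounded_linear_cinner_L2_left multiplier_L2_sums]
  by (simp add: cinner_L2_scaleC_left)

text \<open>The weights are real, so conjugating each term of the series for the pairing only
  exchanges the roles of \<open>f\<close> and \<open>g\<close>.\<close>

lemma multiplier_L2_selfadjoint: "is_adjoint_L2 (multiplier_L2 \<xi> w) (multiplier_L2 \<xi> w)"
proof -
  have "cinner_L2 (multiplier_L2 \<xi> w f) g = cinner_L2 f (multiplier_L2 \<xi> w g)" for f g
  proof (rule sums_unique2[OF cinner_multiplier_L2_sums])
    have "(\<lambda>k. cnj (of_real (w k) * cinner_L2 g (char_L2 (\<xi> k)) * cinner_L2 (char_L2 (\<xi> k)) f))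
        sums cnj (cinner_L2 (multiplier_L2 \<xi> w g) f)"
      by (subst sums_cnj) (rule cinner_multiplier_L2_sums)
    moreover have "cnj (of_real (w k) * cinner_L2 g (char_L2 (\<xi> k)) * cinner_L2 (char_L2 (\<xi> k)) f)
        = of_real (w k) * cinner_L2 f (char_L2 (\<xi> k)) * cinner_L2 (char_L2 (\<xi> k)) g" for k
      by (simp add: mult_ac flip: cinner_L2_commute)
    ultimately show "(\<lambda>k. of_real (w k) * cinner_L2 f (char_L2 (\<xi> k)) * cinner_L2 (char_L2 (\<xi> k)) g)
        sums cinner_L2 f (multiplier_L2 \<xi> w g)"
      by (simp add: mult_ac flip: cinner_L2_commute)
  qed
  then show ?thesis by (simp add: is_adjoint_L2_def bounded_clinear_multiplier_L2)
qed

text \<open>The quadratic form is the sum of the real nonnegative numbers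
  \<open>w k * (cmod (cinner_L2 f (char_L2 (\<xi> k))))\<^sup>2\<close>.\<close>

lemma positive_multiplier_L2: "positive_operator_L2 (multiplier_L2 \<xi> w)"
proof -
  have "cinner_L2 (multiplier_L2 \<xi> w f) f \<in> \<real> \<and> 0 \<le> Re (cinner_L2 (multiplier_L2 \<xi> w f) f)" for f
  proof -
    have "of_real (w k) * cinner_L2 f (char_L2 (\<xi> k)) * cinner_L2 (char_L2 (\<xi> k)) f
        = complex_of_real (w k * (cmod (cinner_L2 f (char_L2 (\<xi> k))))\<^sup>2)" for k
      unfolding of_real_mult complex_norm_square
      by (subst (2) cinner_L2_commute) (simp add: mult.assoc)
    with cinner_multiplier_L2_sums[of f f]
    have s: "(\<lambda>k. complex_of_real (w k * (cmod (cinner_L2 f (char_L2 (\<xi> k))))\<^sup>2))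
        sums cinner_L2 (multiplier_L2 \<xi> w f) f"
      by simp
    have nonneg: "0 \<le> w k * (cmod (cinner_L2 f (char_L2 (\<xi> k))))\<^sup>2" for k
      using w(2)[of k] by simp
    have "(\<lambda>k. 0) sums Im (cinner_L2 (multiplier_L2 \<xi> w f) f)"
      using sums_Im[OF s] by simp
    then have "Im (cinner_L2 (multiplier_L2 \<xi> w f) f) = 0"
      using sums_unique2 sums_zero by blast
    moreover have re: "(\<lambda>k. w k * (cmod (cinner_L2 f (char_L2 (\<xi> k))))\<^sup>2)
        sums Re (cinner_L2 (multiplier_L2 \<xi> w f) f)"
      using sums_Re[OF s] by simp
    have "0 \<le> Re (cinner_L2 (multiplier_L2 \<xi> w f) f)"
      by (rule sums_le[OF nonneg sums_zero re])
    ultimately show ?thesis by (simp add: complex_is_Real_iff)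
  qed
  then show ?thesis
    by (simp add: positive_operator_L2_def bounded_clinear_multiplier_L2)
qed

text \<open>For a positive operator that is its own adjoint, both sides of
  \<open>S \<circ> S = T' \<circ> T\<close> are the square of the operator.\<close>

lemma is_abs_multiplier_L2: "is_abs_L2 (multiplier_L2 \<xi> w) (multiplier_L2 \<xi> w)"
  unfolding is_abs_L2_def using positive_multiplier_L2 multiplier_L2_selfadjoint by blast

lemma compact_multiplier_L2: "compact_operator_L2 (multiplier_L2 \<xi> w)"
proof -
  \<comment> \<open>\<open>Q\<close> contains the coefficient sequences of all vectors in the unit
    ball and is compact by Tychonoff. The map \<open>\<Phi>\<close> performs the weighted synthesis
    from such a sequence.\<close>
  define Q :: "(nat \<Rightarrow> complex) set" where "Q = PiE UNIV (\<lambda>_. cball 0 1)"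
  define \<Phi> :: "(nat \<Rightarrow> complex) \<Rightarrow> 'n torus_L2" where
    "\<Phi> c = L2_class (fourier_series \<xi> (\<lambda>k. of_real (w k) * c k))" for c
  have Q: "cmod (c k) \<le> 1" if "c \<in> Q" for c k using that by (auto simp: Q_def PiE_iff)
  have sm: "summable (\<lambda>k. cmod (of_real (w k) * c k))" if "c \<in> Q" for c
    using w Q[OF that] by (intro summable_mult_bounded[where B = 1]) (auto intro: less_imp_le)
  have "compact Q"
    using compactin_PiE[of "\<lambda>_. euclidean" UNIV "\<lambda>_ :: nat. cball (0 :: complex) 1"]
    by (simp add: Q_def euclidean_product_topology)
  \<comment> \<open>Each partial sum depends on finitely many coordinates, so it is continuous in
    the product topology. The tail of \<open>w\<close> bounds the error for all \<open>c\<close> in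
    \<open>Q\<close> at once, which makes \<open>\<Phi>\<close> continuous.\<close>
  have "uniform_limit Q (\<lambda>N c. \<Sum>k<N. scaleC_L2 (of_real (w k) * c k) (char_L2 (\<xi> k))) \<Phi> sequentially"
  proof (rule uniform_limitI)
    fix e :: real assume "0 < e"
    have "\<forall>\<^sub>F N in sequentially. (\<Sum>k. w (k + N)) < e"
      using suminf_tail_tendsto_0[OF w(1)] \<open>0 < e\<close> by (rule order_tendstoD)
    then show "\<forall>\<^sub>F N in sequentially. \<forall>c\<in>Q.
        dist (\<Sum>k<N. scaleC_L2 (of_real (w k) * c k) (char_L2 (\<xi> k))) (\<Phi> c) < e"
    proof (rule eventually_mono, intro ballI)
      fix N c assume N: "(\<Sum>k. w (k + N)) < e" and c: "c \<in> Q"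
      have "norm (\<Phi> c - (\<Sum>k<N. scaleC_L2 (of_real (w k) * c k) (char_L2 (\<xi> k))))
          \<le> (\<Sum>k. cmod (of_real (w (k + N)) * c (k + N)))"
        unfolding \<Phi>_def by (rule norm_fourier_series_minus_partial_sum_le[OF sm[OF c]])
      also have "\<dots> \<le> (\<Sum>k. w (k + N))"
      proof (rule suminf_le)
        show "cmod (of_real (w (k + N)) * c (k + N)) \<le> w (k + N)" for k
          using Q[OF c, of "k + N"] w(2)[of "k + N"] by (simp add: norm_mult mult_left_le)
      qed (use summable_ignore_initial_segment[OF sm[OF c]] summable_ignore_initial_segment[OF w(1)] in auto)
      also have "\<dots> < e" by (rule N)
      finally show "dist (\<Sum>k<N. scaleC_L2 (of_real (w k) * c k) (char_L2 (\<xi> k))) (\<Phi> c) < e"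
        by (simp add: dist_norm norm_minus_commute)
    qed
  qed
  then have "continuous_on Q \<Phi>"
  proof (rule uniform_limit_theorem[rotated])
    have coord: "continuous_on Q (\<lambda>c. c k)" for k
      by (rule continuous_on_subset[OF continuous_on_product_coordinates]) simp
    have "continuous_on Q (\<lambda>c. \<Sum>k<N. scaleC_L2 (of_real (w k) * c k) (char_L2 (\<xi> k)))" for N
      by (intro continuous_on_sum bounded_linear.continuous_on[OF bounded_linear_scaleC_L2_left]
          continuous_on_mult continuous_on_const coord)
    then show "\<forall>\<^sub>F N in sequentially.
        continuous_on Q (\<lambda>c. \<Sum>k<N. scaleC_L2 (of_real (w k) * c k) (char_L2 (\<xi> k)))"
      by simp
  qed simp
  then have comp: "compact (\<Phi> ` Q)" using \<open>compact Q\<close> by (rule compact_continuous_image)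
  have "multiplier_L2 \<xi> w ` cball 0 1 \<subseteq> \<Phi> ` Q"
  proof
    fix h assume "h \<in> multiplier_L2 \<xi> w ` cball 0 1"
    then obtain f where f: "norm f \<le> 1" and h: "h = multiplier_L2 \<xi> w f" by auto
    have "(\<lambda>k. cinner_L2 f (char_L2 (\<xi> k))) \<in> Q"
      using f order_trans[OF cmod_cinner_char_L2_le] by (auto simp: Q_def)
    then show "h \<in> \<Phi> ` Q" unfolding h multiplier_L2_def \<Phi>_def by (rule imageI)
  qed
  \<comment> \<open>A compact image is closed, so it also contains the closure, which is compact as
    a closed subset.\<close>
  then have "closure (multiplier_L2 \<xi> w ` cball 0 1) \<subseteq> \<Phi> ` Q"
    using compact_imp_closed[OF comp] by (rule closure_minimal)
  then have "compact (closure (multiplier_L2 \<xi> w ` cball 0 1))"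
    using compact_Int_closed[OF comp closed_closure] by (metis inf.absorb2)
  then show ?thesis by (simp add: compact_operator_L2_def bounded_clinear_multiplier_L2)
qed

lemma cinner_multiplier_L2_char:
  assumes "inj \<xi>"
  shows "cinner_L2 (multiplier_L2 \<xi> w f) (char_L2 (\<xi> j)) = of_real (w j) * cinner_L2 f (char_L2 (\<xi> j))"
proof (rule sums_unique2[OF cinner_multiplier_L2_sums])
  have "(\<lambda>k. if k = j then of_real (w j) * cinner_L2 f (char_L2 (\<xi> j)) else 0)
      sums (of_real (w j) * cinner_L2 f (char_L2 (\<xi> j)))"
    by (rule sums_single)
  moreover have "of_real (w k) * cinner_L2 f (char_L2 (\<xi> k)) * cinner_L2 (char_L2 (\<xi> k)) (char_L2 (\<xi> j))
      = (if k = j then of_real (w j) * cinner_L2 f (char_L2 (\<xi> j)) else 0)" for k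
    using assms by (simp add: cinner_char_L2 inj_eq)
  ultimately show "(\<lambda>k. of_real (w k) * cinner_L2 f (char_L2 (\<xi> k)) * cinner_L2 (char_L2 (\<xi> k)) (char_L2 (\<xi> j)))
      sums (of_real (w j) * cinner_L2 f (char_L2 (\<xi> j)))"
    by simp
qed

text \<open>Comparing coefficients, an eigenvector for \<open>\<mu>\<close> has zero coefficient at
  every \<open>\<xi> k\<close> with \<open>w k \<noteq> \<mu>\<close>. The expansion of its image,
  which is \<open>\<mu>\<close> times the vector, is then a finite sum, and dividing by
  \<open>\<mu>\<close> puts the vector in the span.\<close>

lemma eigenspace_multiplier_L2:
  assumes "inj \<xi>" "inj w" "0 < \<mu>"
  shows "eigenspace_L2 (multiplier_L2 \<xi> w) \<mu> = L2.span ((\<lambda>k. char_L2 (\<xi> k)) ` {k. w k = \<mu>})"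
proof (intro subset_antisym subsetI)
  fix f assume "f \<in> eigenspace_L2 (multiplier_L2 \<xi> w) \<mu>"
  then have f: "multiplier_L2 \<xi> w f = scaleC_L2 (of_real \<mu>) f" by (simp add: eigenspace_L2_def)
  have coeff: "cinner_L2 f (char_L2 (\<xi> j)) = 0" if "w j \<noteq> \<mu>" for j
    using cinner_multiplier_L2_char[OF assms(1), of f j] that by (simp add: f cinner_L2_scaleC_left)
  have "finite {k. w k = \<mu>}"
    using finite_vimageI[OF _ assms(2), of "{\<mu>}"] by (simp add: vimage_def)
  then have "(\<lambda>k. scaleC_L2 (of_real (w k) * cinner_L2 f (char_L2 (\<xi> k))) (char_L2 (\<xi> k)))
      sums (\<Sum>k\<in>{k. w k = \<mu>}. scaleC_L2 (of_real (w k) * cinner_L2 f (char_L2 (\<xi> k))) (char_L2 (\<xi> k)))"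
    by (rule sums_finite) (simp add: coeff)
  from sums_unique2[OF this multiplier_L2_sums]
  have "scaleC_L2 (of_real \<mu>) f =
      (\<Sum>k\<in>{k. w k = \<mu>}. scaleC_L2 (of_real (w k) * cinner_L2 f (char_L2 (\<xi> k))) (char_L2 (\<xi> k)))"
    by (simp only: f)
  also have "\<dots> \<in> L2.span ((\<lambda>k. char_L2 (\<xi> k)) ` {k. w k = \<mu>})"
    by (intro L2.span_sum L2.span_scale L2.span_base imageI)
  finally have "scaleC_L2 (of_real \<mu>) f \<in> L2.span ((\<lambda>k. char_L2 (\<xi> k)) ` {k. w k = \<mu>})" .
  from L2.span_scale[OF this, of "1 / of_real \<mu>"]
  show "f \<in> L2.span ((\<lambda>k. char_L2 (\<xi> k)) ` {k. w k = \<mu>})"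
    using assms(3) by (simp add: scaleC_L2_scaleC scaleC_L2_one)
next
  have char: "multiplier_L2 \<xi> w (char_L2 (\<xi> j)) = scaleC_L2 (of_real (w j)) (char_L2 (\<xi> j))" for j
  proof (rule sums_unique2[OF multiplier_L2_sums])
    have "(\<lambda>k. if k = j then scaleC_L2 (of_real (w j)) (char_L2 (\<xi> j)) else 0)
        sums scaleC_L2 (of_real (w j)) (char_L2 (\<xi> j))"
      by (rule sums_single)
    moreover have "scaleC_L2 (of_real (w k) * cinner_L2 (char_L2 (\<xi> j)) (char_L2 (\<xi> k))) (char_L2 (\<xi> k))
        = (if k = j then scaleC_L2 (of_real (w j)) (char_L2 (\<xi> j)) else 0)" for k
      using assms(1) by (auto simp: cinner_char_L2 inj_eq)
    ultimately show "(\<lambda>k. scaleC_L2 (of_real (w k) * cinner_L2 (char_L2 (\<xi> j)) (char_L2 (\<xi> k))) (char_L2 (\<xi> k)))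
        sums scaleC_L2 (of_real (w j)) (char_L2 (\<xi> j))"
      by simp
  qed
  have sub: "L2.subspace (eigenspace_L2 (multiplier_L2 \<xi> w) \<mu>)"
  proof (rule L2.subspaceI)
    show "0 \<in> eigenspace_L2 (multiplier_L2 \<xi> w) \<mu>"
      using multiplier_L2_scaleC[of 0 0] by (simp add: eigenspace_L2_def)
  qed (auto simp: eigenspace_L2_def multiplier_L2_add multiplier_L2_scaleC scaleC_L2_add_right
      scaleC_L2_scaleC mult.commute)
  fix f assume "f \<in> L2.span ((\<lambda>k. char_L2 (\<xi> k)) ` {k. w k = \<mu>})"
  moreover have "L2.span ((\<lambda>k. char_L2 (\<xi> k)) ` {k. w k = \<mu>}) \<subseteq> eigenspace_L2 (multiplier_L2 \<xi> w) \<mu>"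
    by (rule L2.span_minimal[OF _ sub]) (auto simp: eigenspace_L2_def char)
  ultimately show "f \<in> eigenspace_L2 (multiplier_L2 \<xi> w) \<mu>" by blast
qed

text \<open>As \<open>w\<close> is injective, each of its values is a simple eigenvalue and is
  listed once; any other \<open>\<mu> > 0\<close> has a trivial eigenspace and is never
  listed.\<close>

lemma singular_values_multiplier_L2:
  assumes "inj \<xi>" "inj w"
  shows "singular_values_L2 (multiplier_L2 \<xi> w) w"
proof -
  have "finite {k. w k = \<mu>} \<and> card {k. w k = \<mu>} = L2_dim (eigenspace_L2 (multiplier_L2 \<xi> w) \<mu>)"
    if "0 < \<mu>" for \<mu>
  proof (cases "\<mu> \<in> range w")
    case True
    then obtain j where j: "\<mu> = w j" by auto
    then have eq: "{k. w k = \<mu>} = {j}" using assms(2) by (auto simp: inj_eq)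
    have "char_L2 (\<xi> j) \<noteq> 0" using norm_char_L2[of "\<xi> j"] by fastforce
    then have "L2.independent {char_L2 (\<xi> j)}" by simp
    from L2.dim_span_eq_card_independent[OF this] show ?thesis
      unfolding eigenspace_multiplier_L2[OF assms that] eq by simp
  next
    case False
    then have "{k. w k = \<mu>} = {}" by auto
    with L2.dim_span_eq_card_independent[OF L2.independent_empty] show ?thesis
      unfolding eigenspace_multiplier_L2[OF assms that] by simp
  qed
  then show ?thesis
    unfolding singular_values_L2_def using is_abs_multiplier_L2 w(2) by (auto intro: less_imp_le)
qed

lemma multiplier_L2_in_Schatten:
  assumes "inj \<xi>" "inj w" "summable (\<lambda>k. w k powr r)"
  shows "multiplier_L2 \<xi> w \<in> Schatten_L2 r"
  using compact_multiplier_L2 singular_values_multiplier_L2[OF assms(1,2)] assms(3)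
  by (auto simp: Schatten_L2_def)

end

section \<open>Symbols\<close>

lemma has_vector_derivative_torus_char:
  "((\<lambda>t. c * torus_char \<xi> (x + t *\<^sub>R axis j 1)) has_vector_derivative
     c * (2 * of_real pi * \<i> * of_int (\<xi> $ j)) * torus_char \<xi> x) (at 0)"
proof -
  define p where "p = 2 * of_real pi * \<i>"
  \<comment> \<open>The derivative is taken in a complex variable \<open>z\<close> and then
    restricted to the real line.\<close>
  have "((\<lambda>z. c * exp (p * (of_real (x \<bullet> lattice_vec \<xi>) + z * of_int (\<xi> $ j)))) has_field_derivative
      c * (p * of_int (\<xi> $ j)) * exp (p * (of_real (x \<bullet> lattice_vec \<xi>) + of_real 0 * of_int (\<xi> $ j))))
      (at (of_real 0))"
    by (auto intro!: derivative_eq_intros)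
  from has_vector_derivative_real_field[OF this]
  show ?thesis
    by (simp add: torus_char_def p_def inner_add_left inner_commute[of "axis j 1"]
        lattice_vec_inner_axis mult.assoc)
qed

lemma torus_smooth_torus_char: "torus_smooth (torus_char \<xi>)"
proof -
  \<comment> \<open>Characters are joint eigenfunctions of the partial derivatives, so iterated
    derivatives stay multiples of the character.\<close>
  have "\<exists>c. partial_derivs js (torus_char \<xi>) = (\<lambda>x. c * torus_char \<xi> x)" for js
  proof (induction js)
    case Nil
    show ?case by (intro exI[of _ 1]) simp
  next
    case (Cons j js)
    then obtain c where "partial_derivs js (torus_char \<xi>) = (\<lambda>x. c * torus_char \<xi> x)" by blast
    then have "partial_derivs (j # js) (torus_char \<xi>)
        = (\<lambda>x. c * (2 * of_real pi * \<i> * of_int (\<xi> $ j)) * torus_char \<xi> x)"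
      by (simp add: partial_deriv_def fun_eq_iff vector_derivative_at[OF has_vector_derivative_torus_char])
    then show ?case by (rule exI)
  qed
  then obtain c where c: "partial_derivs js (torus_char \<xi>) = (\<lambda>x. c js * torus_char \<xi> x)" for js
    by metis
  have "(\<lambda>t. c * torus_char \<xi> (x + t *\<^sub>R axis j 1)) differentiable (at 0)" for c x j
    using has_vector_derivative_torus_char by (rule differentiableI_vector)
  moreover have "continuous_on UNIV (\<lambda>x. c * torus_char \<xi> x)" for c
    by (intro continuous_on_mult continuous_on_const continuous_torus_char)
  ultimately show ?thesis
    by (simp add: torus_smooth_def torus_fun_torus_char c)
qed

section \<open>Recovering the symbol from the operator\<close>

lemma quantization_torus_char: "quantization a (torus_char \<eta>) x = torus_char \<eta> x * a x \<eta>"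
proof -
  have "quantization a (torus_char \<eta>) x
      = (\<Sum>\<^sub>\<infinity>\<xi>\<in>{\<eta>}. torus_char \<xi> x * a x \<xi> * fourier_coeff (torus_char \<eta>) \<xi>)"
    unfolding quantization_def
    by (rule infsum_cong_neutral) (auto simp: fourier_coeff_torus_char)
  then show ?thesis by (simp add: fourier_coeff_torus_char)
qed

text \<open>Characters have no zeros, so the values of the operator on them can be solved for the
  symbol. Hence the symbols quantified in \<open>Psi_00\<close> and \<open>elliptic\<close> can only
  be the given one, and both negative claims become estimates on it.\<close>

lemma symbol_unique:
  assumes "has_symbol A a" "has_symbol A b"
  shows "a = b"
proof (intro ext)
  fix x \<eta>
  have "quantization a (torus_char \<eta>) x = quantization b (torus_char \<eta>) x"
    using assms torus_smooth_torus_char[of \<eta>] by (simp add: has_symbol_def)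
  moreover have "torus_char \<eta> x \<noteq> 0"
    using norm_torus_char[of \<eta> x] by fastforce
  ultimately show "a x \<eta> = b x \<eta>" by (simp add: quantization_torus_char)
qed

lemma partial_derivs_const: "partial_derivs js (\<lambda>_. c) = (\<lambda>_. if js = [] then c else 0)"
  by (induction js) (auto simp: partial_deriv_def fun_eq_iff)

lemma torus_smooth_const: "torus_smooth (\<lambda>_. c)"
  by (simp add: torus_smooth_def torus_fun_def partial_derivs_const)

section \<open>Slow variation of the weight, and symbols independent of the space variable\<close>

lemma japanese_bracket_ge_1: "1 \<le> japanese_bracket \<xi>"
  by (simp add: japanese_bracket_def)

lemma japanese_bracket_pos: "0 < japanese_bracket \<xi>"
  using japanese_bracket_ge_1[of \<xi>] by linarith

lemma norm_le_japanese_bracket: "norm (lattice_vec \<xi>) \<le> japanese_bracket \<xi>"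
proof -
  have "1 * (norm (lattice_vec \<xi>))\<^sup>2 \<le> 4 * pi\<^sup>2 * (norm (lattice_vec \<xi>))\<^sup>2"
    using power_mono[of 1 pi 2] pi_gt3 by (intro mult_right_mono) (simp_all add: power2_eq_square)
  then show ?thesis
    unfolding japanese_bracket_def by (intro real_le_rsqrt) simp
qed

text \<open>A unit shift changes the norm by at most 1, and
  \<open>(q + 1)\<^sup>2 \<le> 2 * q\<^sup>2 + 2\<close>. The constant is chosen generously, so that
  its product with the shifted weight dominates every resulting term.\<close>

lemma japanese_bracket_shift:
  fixes \<xi> :: "int ^ 'n"
  shows "japanese_bracket \<xi> \<le> sqrt (2 + 8 * pi\<^sup>2) * japanese_bracket (\<xi> + axis j 1)"
proof -
  define p q where "p = norm (lattice_vec \<xi>)" and "q = norm (lattice_vec (\<xi> + axis j 1))"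
  have "lattice_vec \<xi> = lattice_vec (\<xi> + axis j 1) - axis j 1"
    by (auto simp: lattice_vec_def vec_eq_iff axis_def)
  then have "p \<le> q + norm (axis j 1 :: real ^ 'n)"
    using norm_triangle_ineq4[of "lattice_vec (\<xi> + axis j 1)" "axis j 1"] by (simp add: p_def q_def)
  then have "p\<^sup>2 \<le> (q + 1)\<^sup>2"
    by (intro power_mono) (auto simp: p_def)
  also have "\<dots> \<le> 2 * q\<^sup>2 + 2"
    using sum_squares_bound[of q 1] by (simp add: power2_sum)
  finally have "4 * pi\<^sup>2 * p\<^sup>2 \<le> 4 * pi\<^sup>2 * (2 * q\<^sup>2 + 2)"
    by (intro mult_left_mono) auto
  moreover have "0 \<le> q\<^sup>2 * pi ^ 4" by simp
  moreover have "(2 + 8 * pi\<^sup>2) * (1 + 4 * pi\<^sup>2 * q\<^sup>2) = 2 + 4 * pi\<^sup>2 * (2 * q\<^sup>2 + 2) + 32 * (q\<^sup>2 * pi ^ 4)"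
    by (simp add: algebra_simps)
  ultimately have "1 + 4 * pi\<^sup>2 * p\<^sup>2 \<le> (2 + 8 * pi\<^sup>2) * (1 + 4 * pi\<^sup>2 * q\<^sup>2)"
    by linarith
  then have "sqrt (1 + 4 * pi\<^sup>2 * p\<^sup>2) \<le> sqrt ((2 + 8 * pi\<^sup>2) * (1 + 4 * pi\<^sup>2 * q\<^sup>2))"
    by (rule real_sqrt_le_mono)
  then show ?thesis by (simp add: japanese_bracket_def p_def q_def real_sqrt_mult)
qed

text \<open>Each difference consists of two values of the previous one. Shifting the weight costs a
  factor \<open>K powr \<kappa>\<close>, so the constant grows by \<open>K powr \<kappa> + 1\<close>
  while the order stays the same.\<close>

lemma partial_diffs_bound:
  fixes \<sigma> :: "int ^ 'n \<Rightarrow> complex"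
  assumes "0 \<le> \<kappa>" and "\<And>\<xi>. cmod (\<sigma> \<xi>) \<le> C * japanese_bracket \<xi> powr (- \<kappa>)"
  shows "\<exists>C. \<forall>\<xi>. cmod (partial_diffs js \<sigma> \<xi>) \<le> C * japanese_bracket \<xi> powr (- \<kappa>)"
proof (induction js)
  case Nil
  with assms(2) show ?case by auto
next
  case (Cons j js)
  define K where "K = sqrt (2 + 8 * pi\<^sup>2)"
  have K: "0 < K" unfolding K_def by (simp add: pos_add_strict)
  from Cons obtain C where C: "\<And>\<xi>. cmod (partial_diffs js \<sigma> \<xi>) \<le> C * japanese_bracket \<xi> powr (- \<kappa>)"
    by blast
  have "0 \<le> C * japanese_bracket (0 :: int ^ 'n) powr (- \<kappa>)" using order_trans[OF norm_ge_zero C] .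
  then have "0 \<le> C" using japanese_bracket_pos[of "0 :: int ^ 'n"] by (simp add: zero_le_mult_iff)
  have shift: "japanese_bracket (\<xi> + axis j 1) powr (- \<kappa>) \<le> K powr \<kappa> * japanese_bracket \<xi> powr (- \<kappa>)" for \<xi>
  proof -
    \<comment> \<open>The exponent is not positive, so raising to it reverses the shift
      inequality.\<close>
    have "(K * japanese_bracket (\<xi> + axis j 1)) powr (- \<kappa>) \<le> japanese_bracket \<xi> powr (- \<kappa>)"
      using japanese_bracket_shift[of \<xi> j] japanese_bracket_pos[of \<xi>] assms(1)
      by (intro powr_mono2') (auto simp: K_def)
    then show ?thesis
      using K japanese_bracket_pos[of "\<xi> + axis j 1"] by (simp add: powr_mult powr_minus field_simps)
  qed
  have "cmod (partial_diffs (j # js) \<sigma> \<xi>) \<le> C * (K powr \<kappa> + 1) * japanese_bracket \<xi> powr (- \<kappa>)" for \<xi>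
  proof -
    have "cmod (partial_diffs (j # js) \<sigma> \<xi>)
        \<le> cmod (partial_diffs js \<sigma> (\<xi> + axis j 1)) + cmod (partial_diffs js \<sigma> \<xi>)"
      by (simp add: partial_diff_def norm_triangle_ineq4)
    also have "\<dots> \<le> C * (K powr \<kappa> * japanese_bracket \<xi> powr (- \<kappa>)) + C * japanese_bracket \<xi> powr (- \<kappa>)"
      by (intro add_mono C order_trans[OF C mult_left_mono[OF shift \<open>0 \<le> C\<close>]])
    finally show ?thesis by (simp add: algebra_simps)
  qed
  then show ?case by blast
qed

lemma multiplier_symbol_in_class:
  fixes \<sigma> :: "int ^ 'n \<Rightarrow> complex"
  assumes "0 \<le> \<kappa>" and "\<And>\<xi>. cmod (\<sigma> \<xi>) \<le> C * japanese_bracket \<xi> powr (- \<kappa>)"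
  shows "(\<lambda>_. \<sigma>) \<in> symbol_class_00 (- \<kappa>)"
proof -
  have "\<exists>C. \<forall>x \<xi>. cmod (partial_derivs \<beta> (\<lambda>y. partial_diffs \<alpha> \<sigma> \<xi>) x) \<le> C * japanese_bracket \<xi> powr (- \<kappa>)"
    for \<alpha> \<beta> :: "'n list"
  proof -
    obtain C where C: "\<And>\<xi>. cmod (partial_diffs \<alpha> \<sigma> \<xi>) \<le> C * japanese_bracket \<xi> powr (- \<kappa>)"
      using partial_diffs_bound[OF assms] by blast
    \<comment> \<open>For nonempty \<open>\<beta>\<close> the left side is 0, and the right side is
      nonnegative because it dominates a norm.\<close>
    then have "cmod (partial_derivs \<beta> (\<lambda>y. partial_diffs \<alpha> \<sigma> \<xi>) x) \<le> C * japanese_bracket \<xi> powr (- \<kappa>)" for x \<xi>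
      using order_trans[OF norm_ge_zero C] by (simp add: partial_derivs_const)
    then show ?thesis by blast
  qed
  then show ?thesis by (simp add: symbol_class_00_def torus_smooth_const)
qed

text \<open>The quantization is an unordered sum over the whole lattice. It reduces to the support
  of the symbol, is reindexed along \<open>\<xi>\<close>, and agrees with the ordered series by
  absolute convergence.\<close>

lemma quantization_sparse:
  fixes \<xi> :: "nat \<Rightarrow> int ^ 'n"
  assumes "inj \<xi>" "\<And>\<eta>. \<eta> \<notin> range \<xi> \<Longrightarrow> \<sigma> \<eta> = 0"
    and "summable (\<lambda>k. cmod (\<sigma> (\<xi> k) * fourier_coeff f (\<xi> k)))"
  shows "quantization (\<lambda>_. \<sigma>) f = fourier_series \<xi> (\<lambda>k. \<sigma> (\<xi> k) * fourier_coeff f (\<xi> k))"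
proof
  fix x
  define h where "h \<eta> = torus_char \<eta> x * \<sigma> \<eta> * fourier_coeff f \<eta>" for \<eta>
  have h: "h (\<xi> k) = \<sigma> (\<xi> k) * fourier_coeff f (\<xi> k) * torus_char (\<xi> k) x" for k
    by (simp add: h_def mult_ac)
  have sm: "summable (\<lambda>k. cmod (h (\<xi> k)))" using assms(3) by (simp add: h norm_mult)
  have "((\<lambda>k. h (\<xi> k)) has_sum (\<Sum>k. h (\<xi> k))) UNIV"
    by (rule norm_summable_imp_has_sum[OF sm summable_sums[OF summable_norm_cancel[OF sm]]])
  then have "(\<Sum>\<^sub>\<infinity>k. h (\<xi> k)) = fourier_series \<xi> (\<lambda>k. \<sigma> (\<xi> k) * fourier_coeff f (\<xi> k)) x"
    by (simp add: infsumI fourier_series_def h)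
  moreover have "(\<Sum>\<^sub>\<infinity>\<eta>. h \<eta>) = (\<Sum>\<^sub>\<infinity>\<eta>\<in>range \<xi>. h \<eta>)"
    by (rule infsum_cong_neutral) (auto simp: h_def assms(2))
  moreover have "(\<Sum>\<^sub>\<infinity>\<eta>\<in>range \<xi>. h \<eta>) = (\<Sum>\<^sub>\<infinity>k. h (\<xi> k))"
    by (subst infsum_reindex[OF assms(1)]) (simp add: o_def)
  ultimately show "quantization (\<lambda>_. \<sigma>) f x = fourier_series \<xi> (\<lambda>k. \<sigma> (\<xi> k) * fourier_coeff f (\<xi> k)) x"
    by (simp add: quantization_def h_def)
qed

text \<open>On smooth functions Fourier coefficients are inner products with characters, so the
  operator and the multiplier produce the very same Fourier series.\<close>

lemma L2_extension_multiplier: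
  fixes \<xi> :: "nat \<Rightarrow> int ^ 'n::finite"
  assumes w: "summable w" "\<And>k. 0 < w k"
    and "inj \<xi>" "\<And>\<eta>. \<eta> \<notin> range \<xi> \<Longrightarrow> \<sigma> \<eta> = 0" "\<And>k. \<sigma> (\<xi> k) = of_real (w k)"
  shows "L2_extension (quantization (\<lambda>_. \<sigma>)) (multiplier_L2 \<xi> w)"
  unfolding L2_extension_def
proof (intro conjI allI impI)
  show "bounded_clinear_L2 (multiplier_L2 \<xi> w)" by (rule bounded_clinear_multiplier_L2[OF w])
  fix f :: "real ^ 'n \<Rightarrow> complex" assume "torus_smooth f"
  then have f: "square_integrable f" by (rule torus_smooth_imp_square_integrable)
  have sm: "summable (\<lambda>k. cmod (\<sigma> (\<xi> k) * fourier_coeff f (\<xi> k)))"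
    using summable_multiplier[OF w] by (simp add: assms(5) fourier_coeff_eq_cinner[OF f])
  have eq: "quantization (\<lambda>_. \<sigma>) f = fourier_series \<xi> (\<lambda>k. \<sigma> (\<xi> k) * fourier_coeff f (\<xi> k))"
    by (rule quantization_sparse[OF assms(3,4) sm])
  show "square_integrable (quantization (\<lambda>_. \<sigma>) f)"
    unfolding eq by (rule square_integrable_fourier_series[OF sm])
  show "multiplier_L2 \<xi> w (L2_class f) = L2_class (quantization (\<lambda>_. \<sigma>) f)"
    unfolding eq multiplier_L2_def by (simp add: assms(5) fourier_coeff_eq_cinner[OF f])
qed

section \<open>The lacunary multiplier\<close>

theorem theorem3p12:
  fixes \<kappa> :: real
  assumes "\<kappa> > 0"
  shows "\<exists>A :: (real ^ 'n \<Rightarrow> complex) \<Rightarrow> (real ^ 'n \<Rightarrow> complex).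
           A \<in> Psi_00 (- \<kappa>) \<and>
           (\<forall>\<epsilon>>0. A \<notin> Psi_00 (- \<kappa> - \<epsilon>)) \<and>
           \<not> elliptic (- \<kappa>) A \<and>
           (\<exists>T. L2_extension A T \<and> (\<forall>r>0. T \<in> Schatten_L2 r))"
proof -
  \<comment> \<open>Here \<open>undefined\<close> is one fixed but arbitrary coordinate direction.
    Powers of 2 give geometric decay of \<open>w\<close> and leave the negative half of the axis
    free.\<close>
  define \<xi> :: "nat \<Rightarrow> int ^ 'n" where "\<xi> k = axis undefined (2 ^ k)" for k
  define w where "w k = japanese_bracket (\<xi> k) powr (- \<kappa>)" for k
  define \<sigma> where "\<sigma> \<eta> = (if \<eta> \<in> range \<xi> then of_real (japanese_bracket \<eta> powr (- \<kappa>)) else 0 :: complex)" for \<eta>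
  define A where "A = quantization (\<lambda>_. \<sigma>)"
  have norm_\<xi>: "norm (lattice_vec (\<xi> k)) = 2 ^ k" for k
  proof -
    have "lattice_vec (\<xi> k) = 2 ^ k *\<^sub>R axis undefined 1"
      by (simp add: lattice_vec_def \<xi>_def axis_def vec_eq_iff)
    then show ?thesis by simp
  qed
  have inj: "inj \<xi>" by (simp add: inj_on_def \<xi>_def axis_eq_axis)
  have w_pos: "0 < w k" for k using japanese_bracket_pos[of "\<xi> k"] by (simp add: w_def)
  have bracket_ge: "2 ^ k \<le> japanese_bracket (\<xi> k)" for k
    using norm_le_japanese_bracket[of "\<xi> k"] by (simp add: norm_\<xi>)
  \<comment> \<open>As \<open>\<kappa> \<noteq> 0\<close>, the weight can be recovered from
    \<open>w\<close>, and it determines \<open>2 ^ k\<close>; this is how \<open>w\<close> is seen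
    to be injective.\<close>
  have bracket_eq: "japanese_bracket (\<xi> k) = w k powr (- 1 / \<kappa>)" for k
    using assms japanese_bracket_pos[of "\<xi> k"] by (simp add: w_def powr_powr)
  have "inj w"
  proof (rule injI)
    fix k l assume "w k = w l"
    then have "japanese_bracket (\<xi> k) = japanese_bracket (\<xi> l)"
      by (simp add: bracket_eq)
    then show "k = l" by (simp add: japanese_bracket_def norm_\<xi>)
  qed
  \<comment> \<open>The bound \<open>2 ^ k\<close> for the weight compares the series with a
    geometric one of ratio \<open>2 powr (- \<kappa> * r)\<close>, which is below 1 for every
    \<open>r > 0\<close>; this covers all Schatten exponents at once.\<close>
  have summable_w: "summable (\<lambda>k. w k powr r)" if "0 < r" for r
  proof (rule summable_comparison_test)
    have "norm (w k powr r) \<le> (2 powr (- \<kappa> * r)) ^ k" for k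
    proof -
      have "w k powr r = japanese_bracket (\<xi> k) powr (- \<kappa> * r)" by (simp add: w_def powr_powr)
      also have "\<dots> \<le> (2 ^ k) powr (- \<kappa> * r)"
        using bracket_ge assms that by (intro powr_mono2') auto
      also have "\<dots> = (2 powr (- \<kappa> * r)) ^ k"
        by (simp add: powr_powr mult.commute flip: powr_realpow)
      finally show ?thesis by simp
    qed
    then show "\<exists>N. \<forall>k\<ge>N. norm (w k powr r) \<le> (2 powr (- \<kappa> * r)) ^ k" by blast
    have "2 powr (- \<kappa> * r) < 2 powr 0"
      using assms that by (intro powr_less_mono) auto
    then show "summable (\<lambda>k. (2 powr (- \<kappa> * r)) ^ k)"
      by (intro summable_geometric) simp
  qed
  have sm: "summable w" using summable_w[of 1] w_pos by (simp add: less_imp_le)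
  have "A \<in> Psi_00 (- \<kappa>)"
  proof -
    have "(\<lambda>_. \<sigma>) \<in> symbol_class_00 (- \<kappa>)"
      using assms by (intro multiplier_symbol_in_class[where C = 1]) (auto simp: \<sigma>_def)
    then show ?thesis by (auto simp: Psi_00_def A_def has_symbol_def)
  qed
  have symbol: "a = (\<lambda>_. \<sigma>)" if "has_symbol A a" for a
    using that by (rule symbol_unique) (simp add: has_symbol_def A_def)
  have "A \<notin> Psi_00 (- \<kappa> - \<epsilon>)" if "0 < \<epsilon>" for \<epsilon>
  proof
    assume "A \<in> Psi_00 (- \<kappa> - \<epsilon>)"
    then have "(\<lambda>_. \<sigma>) \<in> symbol_class_00 (- \<kappa> - \<epsilon>)"
      using symbol by (auto simp: Psi_00_def)
    \<comment> \<open>Empty multi-indices extract the bound on the symbol itself.\<close>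
    then have "\<exists>C. \<forall>(x :: real ^ 'n) \<eta>. cmod (partial_derivs [] (\<lambda>y. partial_diffs [] \<sigma> \<eta>) x)
        \<le> C * japanese_bracket \<eta> powr (- \<kappa> - \<epsilon>)"
      unfolding symbol_class_00_def by blast
    then obtain C where C: "\<And>\<eta>. cmod (\<sigma> \<eta>) \<le> C * japanese_bracket \<eta> powr (- \<kappa> - \<epsilon>)"
      by auto
    \<comment> \<open>On the lacunary sequence the symbol has exactly the size of the weight of
      order \<open>- \<kappa>\<close>. A better order would bound
      \<open>japanese_bracket (\<xi> k) powr \<epsilon>\<close>, which grows at least like a power
      of \<open>2 powr \<epsilon>\<close>.\<close>
    have bound: "(2 powr \<epsilon>) ^ k \<le> C" for k
    proof -
      have "japanese_bracket (\<xi> k) powr (- \<kappa>) \<le> C * japanese_bracket (\<xi> k) powr (- \<kappa> - \<epsilon>)"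
        using C[of "\<xi> k"] by (simp add: \<sigma>_def)
      also have "\<dots> = japanese_bracket (\<xi> k) powr (- \<kappa>) * (C / japanese_bracket (\<xi> k) powr \<epsilon>)"
        by (simp add: powr_diff)
      finally have "japanese_bracket (\<xi> k) powr \<epsilon> \<le> C"
        using japanese_bracket_pos[of "\<xi> k"] by (simp add: field_simps)
      moreover have "(2 ^ k) powr \<epsilon> \<le> japanese_bracket (\<xi> k) powr \<epsilon>"
        using bracket_ge that by (intro powr_mono2) auto
      moreover have "(2 ^ k) powr \<epsilon> = (2 powr \<epsilon>) ^ k"
        by (simp add: powr_powr mult.commute flip: powr_realpow)
      ultimately show ?thesis by simp
    qed
    have "1 < (2::real) powr \<epsilon>" using that by simp
    then obtain k where "C < (2 powr \<epsilon>) ^ k" using real_arch_pow by blast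
    with bound[of k] show False by simp
  qed
  moreover have "\<not> elliptic (- \<kappa>) A"
  proof
    assume "elliptic (- \<kappa>) A"
    then obtain c F where "0 < c" "finite F"
      and F: "\<And>\<eta>. \<eta> \<notin> F \<Longrightarrow> c * japanese_bracket \<eta> powr (- \<kappa>) \<le> cmod (\<sigma> \<eta>)"
      unfolding elliptic_def using symbol by fastforce
    \<comment> \<open>The entries \<open>- int m\<close> are never positive, so these frequencies
      avoid the powers of 2. There are infinitely many, so one of them lies outside the finite
      exceptional set \<open>F\<close>, where the symbol would have to be nonzero.\<close>
    define \<eta> :: "nat \<Rightarrow> int ^ 'n" where "\<eta> m = axis undefined (- int m)" for m
    have "inj \<eta>" by (auto simp: inj_on_def \<eta>_def axis_eq_axis)
    then have "infinite (range \<eta>)" by (rule range_inj_infinite)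
    with \<open>finite F\<close> have "\<not> range \<eta> \<subseteq> F" using finite_subset by blast
    then obtain m where m: "\<eta> m \<notin> F" by blast
    have "\<eta> m \<noteq> \<xi> k" for k
    proof -
      have "- int m < 2 ^ k" using zero_less_power[of "2 :: int" k] by linarith
      then show ?thesis by (auto simp: \<eta>_def \<xi>_def axis_eq_axis)
    qed
    then have "\<sigma> (\<eta> m) = 0" by (auto simp: \<sigma>_def)
    with F[OF m] have "c * japanese_bracket (\<eta> m) powr (- \<kappa>) \<le> 0" by simp
    moreover have "0 < c * japanese_bracket (\<eta> m) powr (- \<kappa>)"
      using \<open>0 < c\<close> japanese_bracket_pos[of "\<eta> m"] by simp
    ultimately show False by linarith
  qed
  moreover have "L2_extension A (multiplier_L2 \<xi> w)"
    unfolding A_def by (rule L2_extension_multiplier[OF sm w_pos inj]) (simp_all add: \<sigma>_def w_def)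
  moreover have "multiplier_L2 \<xi> w \<in> Schatten_L2 r" if "0 < r" for r
    by (rule multiplier_L2_in_Schatten[OF sm w_pos inj \<open>inj w\<close> summable_w[OF that]])
  ultimately show ?thesis using \<open>A \<in> Psi_00 (- \<kappa>)\<close> by blast
qed

end
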